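(* Let $\mathbb{K}$ be a field. The simplicial nerve of an $\mathcal{A}_\infty$-category defines a functor $$N_{\mathcal{A}_\infty}:\mathcal{A}_\infty Cat_{\mathbb{K}}\to SSet$$ from the category of small $\mathcal{A}_\infty$-categories over $\mathbb{K}$ to the category of simplicial sets, where an $\mathcal{A}_\infty$-functor $g:\mathcal{A}\to\mathcal{B}$ is sent to the map $(g)_\star:N_{\mathcal{A}_\infty}(\mathcal{A})\to N_{\mathcal{A}_\infty}(\mathcal{B})$ given by $(g)_\star(f)=g\circ f$ for $f\in N_{\mathcal{A}_\infty}(\mathcal{A})_n=Hom_{\mathcal{A}_\infty Cat_{\mathbb{K}}}(\mathcal{A}_\infty[\Delta^n],\mathcal{A})$.
   Context: Graded conventions. All graded vector spaces are $\mathbb{Z}$-graded over $\mathbb{K}$; for homogeneous maps, $(f\otimes g)(x\otimes y)=(-1)^{\deg(x)\deg(g)}f(x)\otimes g(y)$. $\mathcal{A}_\infty$-category. An $\mathcal{A}_\infty$-category $\mathcal{A}$ over $\mathbb{K}$ consists of: a set $Ob(\mathcal{A})$; for all objects $x,y$ a graded vector space $Hom^\bullet_{\mathcal{A}}(x,y)$; for each $n\ge1$ and objects $x_0,\dots,x_n$ a graded map $m_n:Hom^\bullet_{\mathcal{A}}(x_{n-1},x_n)\otimes\dots\otimes Hom^\bullet_{\mathcal{A}}(x_0,x_1)\to Hom^\bullet_{\mathcal{A}}(x_0,x_n)$ of degree $2-n$ such that for every $n\ge1$ $$\sum_{n=r+t+s}(-1)^{sr+t}m_{r+t+1}(Id^{\otimes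 r}\otimes m_s\otimes Id^{\otimes t})=0\qquad(r,t\ge0,\ s\ge1);$$ and for each object $x$ a degree $0$ element $1_x\in Hom^\bullet_{\mathcal{A}}(x,x)$ with $m_2(1_x\otimes a)=a$ and $m_2(a\otimes 1_x)=a$ whenever these make sense, and such that for $n>2$, $m_n$ vanishes whenever one of its arguments is an identity $1_x$. $\mathcal{A}_\infty$-functor. An $\mathcal{A}_\infty$-functor $f:\mathcal{A}\to\mathcal{B}$ consists of a map $f_0:Ob(\mathcal{A})\to Ob(\mathcal{B})$ and, for $n\ge1$ and objects $x_0,\dots,x_n$, graded maps $f_n:Hom^\bullet_{\mathcal{A}}(x_{n-1},x_n)\otimes\dots\otimes Hom^\bullet_{\mathcal{A}}(x_0,x_1)\to Hom^\bullet_{\mathcal{B}}(f_0(x_0),f_0(x_n))$ of degree $1-n$ such that for every $n\ge1$ $$\sum_{n=r+t+s}(-1)^{sr+t}f_{r+t+1}(Id^{\otimes r}\otimes m_s\otimes Id^{\otimes t})=\sum_{\substack{1\le r\le n\\ i_1+\dots+i_r=n}}(-1)^{\epsilon_r(i_1,\dots,i_r)}m'_r(f_{i_1}\otimes\dots\otimes f_{i_r}),$$ where $m'$ denotes the operations of $\mathcal{B}$ and $\epsilon_r(i_1,\dots,i_r)=\sum_{2\le k\le r}\big((1-i_k)\sum_{1\le l\le k-1}i_l\big)$; moreover $f_1(1_x)=1_{f_0(x)}$ and, for $n>1$, $f_n$ vanishes whenever one of its arguments is an identity. Composition is given on objects by composition of maps and by $(f\circ g)_k=\sum_{r=1}^k\sum_{i_1+\dots+i_r=k}(-1)^{\epsilon_r(i_1,\dots,i_r)}f_r(g_{i_1}\otimes\dots\otimes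 g_{i_r})$. This gives the category $\mathcal{A}_\infty Cat_{\mathbb{K}}$ of small $\mathcal{A}_\infty$-categories. The $\mathcal{A}_\infty$-category $\mathcal{A}_\infty[\Delta^n]$. Its objects are $0,1,\dots,n$; $Hom^\bullet(i,j)=\mathbb{K}\cdot(i,j)$ is one-dimensional with generator $(i,j)$ in degree $0$ if $i\le j$, and is $0$ if $i>j$; $m_1=0$, $m_2((j,k)\otimes(i,j))=(i,k)$ for $i\le j\le k$, and $m_n=0$ for $n>2$; the identity of $i$ is $(i,i)$. A monotone map $\theta:[m]\to[n]$ induces the $\mathcal{A}_\infty$-functor $\theta_\star:\mathcal{A}_\infty[\Delta^m]\to\mathcal{A}_\infty[\Delta^n]$ with $\theta_{\star,0}(k)=\theta(k)$, $\theta_{\star,1}(i,j)=(\theta(i),\theta(j))$, $\theta_{\star,p}=0$ for $p\ge2$; this makes $[n]\mapsto\mathcal{A}_\infty[\Delta^n]$ a cosimplicial object of $\mathcal{A}_\infty Cat_{\mathbb{K}}$. Simplicial nerve. $N_{\mathcal{A}_\infty}(\mathcal{A})$ is the simplicial set with $N_{\mathcal{A}_\infty}(\mathcal{A})_n=Hom_{\mathcal{A}_\infty Cat_{\mathbb{K}}}(\mathcal{A}_\infty[\Delta^n],\mathcal{A})$ and simplicial structure induced by precomposition with the functors $\theta_\star$. *)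

theory Defs
  imports Complex_Main "HOL-Library.FuncSet"
begin

section \<open>Categories, functors and simplicial sets\<close>

text \<open>
  Categories are presented by families of hom-sets, which need not be disjoint; composition and
  identities therefore take the objects involved as arguments.  \<^verbatim>\<open>Comp C X Y Z g f\<close> is
  the composite of \<^verbatim>\<open>f\<close> from \<^verbatim>\<open>X\<close> to \<^verbatim>\<open>Y\<close> with
  \<^verbatim>\<open>g\<close> from \<^verbatim>\<open>Y\<close> to \<^verbatim>\<open>Z\<close>.
\<close>

record ('a, 'm) cat =
  Ob :: "'a set"
  Hom :: "'a \<Rightarrow> 'a \<Rightarrow> 'm set"
  Id :: "'a \<Rightarrow> 'm"
  Comp :: "'a \<Rightarrow> 'a \<Rightarrow> 'a \<Rightarrow> 'm \<Rightarrow> 'm \<Rightarrow> 'm"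

locale category =
  fixes C :: "('a, 'm) cat"
  assumes Id_in_Hom: "X \<in> Ob C \<Longrightarrow> Id C X \<in> Hom C X X"
    and Comp_in_Hom: "\<lbrakk>X \<in> Ob C; Y \<in> Ob C; Z \<in> Ob C; f \<in> Hom C X Y; g \<in> Hom C Y Z\<rbrakk>
      \<Longrightarrow> Comp C X Y Z g f \<in> Hom C X Z"
    and Comp_Id_left: "\<lbrakk>X \<in> Ob C; Y \<in> Ob C; f \<in> Hom C X Y\<rbrakk> \<Longrightarrow> Comp C X Y Y (Id C Y) f = f"
    and Comp_Id_right: "\<lbrakk>X \<in> Ob C; Y \<in> Ob C; f \<in> Hom C X Y\<rbrakk> \<Longrightarrow> Comp C X X Y f (Id C X) = f"
    and Comp_assoc: "\<lbrakk>W \<in> Ob C; X \<in> Ob C; Y \<in> Ob C; Z \<in> Ob C;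
        f \<in> Hom C W X; g \<in> Hom C X Y; h \<in> Hom C Y Z\<rbrakk>
      \<Longrightarrow> Comp C W X Z (Comp C X Y Z h g) f = Comp C W Y Z h (Comp C W X Y g f)"

record ('a, 'm, 'b, 'n) cat_map =
  on_ob :: "'a \<Rightarrow> 'b"
  on_hom :: "'a \<Rightarrow> 'a \<Rightarrow> 'm \<Rightarrow> 'n"

locale cat_functor = dom: category C + cod: category D
  for C :: "('a, 'm) cat" and D :: "('b, 'n) cat" +
  fixes F :: "('a, 'm, 'b, 'n) cat_map"
  assumes on_ob_in_Ob: "X \<in> Ob C \<Longrightarrow> on_ob F X \<in> Ob D"
    and on_hom_in_Hom: "\<lbrakk>X \<in> Ob C; Y \<in> Ob C; f \<in> Hom C X Y\<rbrakk>
      \<Longrightarrow> on_hom F X Y f \<in> Hom D (on_ob F X) (on_ob F Y)"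
    and on_hom_Id: "X \<in> Ob C \<Longrightarrow> on_hom F X X (Id C X) = Id D (on_ob F X)"
    and on_hom_Comp: "\<lbrakk>X \<in> Ob C; Y \<in> Ob C; Z \<in> Ob C; f \<in> Hom C X Y; g \<in> Hom C Y Z\<rbrakk>
      \<Longrightarrow> on_hom F X Z (Comp C X Y Z g f)
        = Comp D (on_ob F X) (on_ob F Y) (on_ob F Z) (on_hom F Y Z g) (on_hom F X Y f)"

definition op_cat :: "('a, 'm) cat \<Rightarrow> ('a, 'm) cat" where
  "op_cat C = \<lparr>Ob = Ob C, Hom = (\<lambda>X Y. Hom C Y X), Id = Id C,
     Comp = (\<lambda>X Y Z g f. Comp C Z Y X f g)\<rparr>"

definition nat_trans ::
  "('a, 'm) cat \<Rightarrow> ('b, 'n) cat \<Rightarrow> ('a, 'm, 'b, 'n) cat_map \<Rightarrow> ('a, 'm, 'b, 'n) cat_map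
    \<Rightarrow> ('a \<Rightarrow> 'n) set" where
  "nat_trans C D F G = {\<eta> \<in> extensional (Ob C).
     (\<forall>X\<in>Ob C. \<eta> X \<in> Hom D (on_ob F X) (on_ob G X)) \<and>
     (\<forall>X\<in>Ob C. \<forall>Y\<in>Ob C. \<forall>f\<in>Hom C X Y.
        Comp D (on_ob F X) (on_ob F Y) (on_ob G Y) (\<eta> Y) (on_hom F X Y f)
        = Comp D (on_ob F X) (on_ob G X) (on_ob G Y) (on_hom G X Y f) (\<eta> X))}"

definition functor_cat ::
  "('a, 'm) cat \<Rightarrow> ('b, 'n) cat \<Rightarrow> (('a, 'm, 'b, 'n) cat_map, 'a \<Rightarrow> 'n) cat" where
  "functor_cat C D = \<lparr>Ob = {F. cat_functor C D F}, Hom = nat_trans C D,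
     Id = (\<lambda>F. \<lambda>X\<in>Ob C. Id D (on_ob F X)),
     Comp = (\<lambda>F G H \<theta> \<eta>. \<lambda>X\<in>Ob C. Comp D (on_ob F X) (on_ob G X) (on_ob H X) (\<theta> X) (\<eta> X))\<rparr>"

definition Set_cat :: "('s set, 's \<Rightarrow> 's) cat" where
  "Set_cat = \<lparr>Ob = UNIV, Hom = (\<lambda>X Y. X \<rightarrow>\<^sub>E Y), Id = (\<lambda>X. \<lambda>x\<in>X. x),
     Comp = (\<lambda>X Y Z g f. compose X g f)\<rparr>"

text \<open>The natural number \<^verbatim>\<open>n\<close> stands for the ordinal with elements 0, ..., n.\<close>

definition Delta_cat :: "(nat, nat \<Rightarrow> nat) cat" where
  "Delta_cat = \<lparr>Ob = UNIV, Hom = (\<lambda>m n. {\<theta> \<in> {..m} \<rightarrow>\<^sub>E {..n}. mono_on {..m} \<theta>}),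
     Id = (\<lambda>n. \<lambda>k\<in>{..n}. k), Comp = (\<lambda>l m n \<theta> \<phi>. compose {..l} \<theta> \<phi>)\<rparr>"

type_synonym 's sset = "(nat, nat \<Rightarrow> nat, 's set, 's \<Rightarrow> 's) cat_map"

definition SSet :: "('s sset, nat \<Rightarrow> 's \<Rightarrow> 's) cat" where
  "SSet = functor_cat (op_cat Delta_cat) Set_cat"


section \<open>A-infinity categories\<close>

text \<open>
  A graded vector space is a family of vector spaces indexed by the integers, and a multilinear
  graded map is a family of multilinear maps on homogeneous elements.  A homogeneous element of
  a hom-space is recorded together with its source, target and degree, because the subspaces
  \<^verbatim>\<open>homs A x y d\<close> of the ambient type for different \<^verbatim>\<open>x\<close>, \<^verbatim>\<open>y\<close>, \<^verbatim>\<open>d\<close> may overlap.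
\<close>

datatype ('o, 'v) arr = Arr (src: 'o) (tgt: 'o) (deg: int) (vec: 'v)

record ('k, 'o, 'v) ainf =
  objs :: "'o set"
  homs :: "'o \<Rightarrow> 'o \<Rightarrow> int \<Rightarrow> 'v set"
  scl :: "'k \<Rightarrow> 'v \<Rightarrow> 'v"
  mu :: "('o, 'v) arr list \<Rightarrow> 'v"
  unt :: "'o \<Rightarrow> 'v"

definition arrows :: "('k, 'o, 'v) ainf \<Rightarrow> ('o, 'v) arr set" where
  "arrows A = {a. src a \<in> objs A \<and> tgt a \<in> objs A \<and> vec a \<in> homs A (src a) (tgt a) (deg a)}"

text \<open>
  The list \<^verbatim>\<open>[a\<^sub>n, ..., a\<^sub>1]\<close> stands for the tensor of the \<^verbatim>\<open>a\<^sub>i\<close> in that order,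
  where \<^verbatim>\<open>a\<^sub>i\<close> goes from \<^verbatim>\<open>x\<^sub>i\<^sub>-\<^sub>1\<close> to \<^verbatim>\<open>x\<^sub>i\<close>; its length is the index of the operation
  \<^verbatim>\<open>m\<^sub>n\<close> or \<^verbatim>\<open>f\<^sub>n\<close> applied to it.
\<close>

definition chains :: "('k, 'o, 'v) ainf \<Rightarrow> ('o, 'v) arr list set" where
  "chains A = {as. as \<noteq> [] \<and> set as \<subseteq> arrows A \<and> successively (\<lambda>b a. src b = tgt a) as}"

definition degs :: "('o, 'v) arr list \<Rightarrow> int" where
  "degs as = sum_list (map deg as)"

definition unit_arr :: "('k, 'o, 'v) ainf \<Rightarrow> 'o \<Rightarrow> ('o, 'v) arr" where
  "unit_arr A x = Arr x x 0 (unt A x)"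

definition mu_arr :: "('k, 'o, 'v) ainf \<Rightarrow> ('o, 'v) arr list \<Rightarrow> ('o, 'v) arr" where
  "mu_arr A as = Arr (src (last as)) (tgt (hd as)) (degs as + 2 - int (length as)) (mu A as)"

definition multilinear ::
  "('k, 'o, 'v::ab_group_add) ainf \<Rightarrow> ('k \<Rightarrow> 'w \<Rightarrow> 'w) \<Rightarrow> (('o, 'v) arr list \<Rightarrow> 'w::ab_group_add)
    \<Rightarrow> bool" where
  "multilinear A s F \<longleftrightarrow> (\<forall>as bs x y d u v c. as @ [Arr x y d u] @ bs \<in> chains A \<longrightarrow> v \<in> homs A x y d \<longrightarrow>
     F (as @ [Arr x y d (u + v)] @ bs) = F (as @ [Arr x y d u] @ bs) + F (as @ [Arr x y d v] @ bs) \<and>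
     F (as @ [Arr x y d (scl A c u)] @ bs) = s c (F (as @ [Arr x y d u] @ bs)))"

definition sgn_pow :: "int \<Rightarrow> 'v \<Rightarrow> 'v::ab_group_add" where
  "sgn_pow e v = (if even e then v else - v)"

text \<open>
  The sum over \<^verbatim>\<open>n = r + s + t\<close> of the terms \<^verbatim>\<open>F (Id\<^sup>r \<otimes> m\<^sub>s \<otimes> Id\<^sup>t)\<close> with sign
  \<^verbatim>\<open>s r + t\<close>, evaluated on a tensor.  The last summand of the exponent is the Koszul sign:
  the operation \<^verbatim>\<open>m\<^sub>s\<close>, of degree \<^verbatim>\<open>2 - s\<close>, is moved past the first \<^verbatim>\<open>r\<close> factors.
\<close>

definition insertion_sum ::
  "('k, 'o, 'v) ainf \<Rightarrow> (('o, 'v) arr list \<Rightarrow> 'w::ab_group_add) \<Rightarrow> ('o, 'v) arr list \<Rightarrow> 'w" where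
  "insertion_sum A F as = (\<Sum>(xs, ys, zs) \<in> {(xs, ys, zs). xs @ ys @ zs = as \<and> ys \<noteq> []}.
     sgn_pow (int (length ys) * int (length xs) + int (length zs) + (2 - int (length ys)) * degs xs)
       (F (xs @ [mu_arr A ys] @ zs)))"

locale ainf_category = vector_space "scl A"
  for A :: "('k::field, 'o, 'v::ab_group_add) ainf" +
  assumes homs_subspace: "\<lbrakk>x \<in> objs A; y \<in> objs A\<rbrakk> \<Longrightarrow> subspace (homs A x y d)"
    and mu_multilinear: "multilinear A (scl A) (mu A)"
    and mu_degree: "as \<in> chains A
      \<Longrightarrow> mu A as \<in> homs A (src (last as)) (tgt (hd as)) (degs as + 2 - int (length as))"
    and mu_relation: "as \<in> chains A \<Longrightarrow> insertion_sum A (mu A) as = 0"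
    and unt_degree: "x \<in> objs A \<Longrightarrow> unt A x \<in> homs A x x 0"
    and mu_unt_left: "a \<in> arrows A \<Longrightarrow> mu A [unit_arr A (tgt a), a] = vec a"
    and mu_unt_right: "a \<in> arrows A \<Longrightarrow> mu A [a, unit_arr A (src a)] = vec a"
    and mu_unt_zero: "\<lbrakk>as \<in> chains A; length as > 2; x \<in> objs A; unit_arr A x \<in> set as\<rbrakk>
      \<Longrightarrow> mu A as = 0"


section \<open>A-infinity functors\<close>

record ('o, 'v, 'p, 'w) ainf_map =
  obj_map :: "'o \<Rightarrow> 'p"
  hom_map :: "('o, 'v) arr list \<Rightarrow> 'w"

definition map_arr :: "('o, 'v, 'p, 'w) ainf_map \<Rightarrow> ('o, 'v) arr list \<Rightarrow> ('p, 'w) arr" where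
  "map_arr f as = Arr (obj_map f (src (last as))) (obj_map f (tgt (hd as)))
     (degs as + 1 - int (length as)) (hom_map f as)"

text \<open>List positions start at 0, so position \<^verbatim>\<open>k\<close> holds the part with index \<^verbatim>\<open>k + 1\<close>.\<close>

definition eps :: "nat list \<Rightarrow> int" where
  "eps is = (\<Sum>k = 1..<length is. (1 - int (is ! k)) * (\<Sum>l<k. int (is ! l)))"

text \<open>
  The Koszul sign exponent for evaluating a tensor product of maps of degrees
  \<^verbatim>\<open>gs\<close> on a tensor product of elements of degrees \<^verbatim>\<open>xs\<close>.
\<close>

definition koszul :: "int list \<Rightarrow> int list \<Rightarrow> int" where
  "koszul gs xs = (\<Sum>k<length gs. gs ! k * (\<Sum>l<k. xs ! l))"

text \<open>
  The signed sum of the \<^verbatim>\<open>F (f\<^sub>i\<^sub>1 \<otimes> ... \<otimes> f\<^sub>i\<^sub>r)\<close> over all \<^verbatim>\<open>i\<^sub>1 + ... + i\<^sub>r = n\<close>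
  evaluated on a tensor of length \<^verbatim>\<open>n\<close>; the compositions of \<^verbatim>\<open>n\<close> correspond to the ways of
  cutting the list into nonempty blocks.
\<close>

definition block_sum ::
  "(('p, 'w) arr list \<Rightarrow> 'z::ab_group_add) \<Rightarrow> ('o, 'v, 'p, 'w) ainf_map \<Rightarrow> ('o, 'v) arr list \<Rightarrow> 'z" where
  "block_sum F f as = (\<Sum>bss \<in> {bss. concat bss = as \<and> [] \<notin> set bss}.
     sgn_pow (eps (map length bss) + koszul (map (\<lambda>bs. 1 - int (length bs)) bss) (map degs bss))
       (F (map (map_arr f) bss)))"

text \<open>Functors are normalised outside their domain, so that equality of functors is equality of
  the object maps and of all the multilinear maps.\<close>

locale ainf_functor =
  fixes A :: "('k::field, 'o, 'v::ab_group_add) ainf"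
    and B :: "('k, 'p, 'w::ab_group_add) ainf"
    and f :: "('o, 'v, 'p, 'w) ainf_map"
  assumes obj_map_in: "obj_map f \<in> objs A \<rightarrow>\<^sub>E objs B"
    and hom_map_extensional: "hom_map f \<in> extensional (chains A)"
    and hom_map_multilinear: "multilinear A (scl B) (hom_map f)"
    and hom_map_degree: "as \<in> chains A
      \<Longrightarrow> hom_map f as \<in> homs B (obj_map f (src (last as))) (obj_map f (tgt (hd as)))
            (degs as + 1 - int (length as))"
    and hom_map_relation: "as \<in> chains A
      \<Longrightarrow> insertion_sum A (hom_map f) as = block_sum (mu B) f as"
    and hom_map_unt: "x \<in> objs A \<Longrightarrow> hom_map f [unit_arr A x] = unt B (obj_map f x)"
    and hom_map_unt_zero: "\<lbrakk>as \<in> chains A; length as > 1; x \<in> objs A; unit_arr A x \<in> set as\<rbrakk>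
      \<Longrightarrow> hom_map f as = 0"

definition ainf_comp ::
  "('k, 'o, 'v) ainf \<Rightarrow> ('p, 'w, 'q, 'z::ab_group_add) ainf_map \<Rightarrow> ('o, 'v, 'p, 'w) ainf_map
    \<Rightarrow> ('o, 'v, 'q, 'z) ainf_map" where
  "ainf_comp A f g = \<lparr>obj_map = compose (objs A) (obj_map f) (obj_map g),
     hom_map = restrict (block_sum (hom_map f) g) (chains A)\<rparr>"

definition ainf_id :: "('k, 'o, 'v::zero) ainf \<Rightarrow> ('o, 'v, 'o, 'v) ainf_map" where
  "ainf_id A = \<lparr>obj_map = (\<lambda>x\<in>objs A. x),
     hom_map = (\<lambda>as\<in>chains A. if length as = 1 then vec (hd as) else 0)\<rparr>"

definition AInf_Cat ::
  "(('k::field, 'o, 'v::ab_group_add) ainf, ('o, 'v, 'o, 'v) ainf_map) cat" where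
  "AInf_Cat = \<lparr>Ob = {A. ainf_category A}, Hom = (\<lambda>A B. {f. ainf_functor A B f}),
     Id = ainf_id, Comp = (\<lambda>A B C g f. ainf_comp A g f)\<rparr>"


section \<open>The simplicial nerve\<close>

text \<open>Where \<^verbatim>\<open>i \<le> j\<close>, the generator of the homs from \<^verbatim>\<open>i\<close> to \<^verbatim>\<open>j\<close> is the scalar 1.
  All other homs consist of the scalar 0 only, so that \<^verbatim>\<open>m\<^sub>2\<close> is always the product of scalars.\<close>

definition ainf_simplex :: "nat \<Rightarrow> ('k::field, nat, 'k) ainf" where
  "ainf_simplex n = \<lparr>objs = {..n}, homs = (\<lambda>i j d. if i \<le> j \<and> d = 0 then UNIV else {0}),
     scl = (*), mu = (\<lambda>as. if length as = 2 then vec (as ! 0) * vec (as ! 1) else 0),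
     unt = (\<lambda>i. 1)\<rparr>"

definition simplex_map :: "nat \<Rightarrow> (nat \<Rightarrow> nat) \<Rightarrow> (nat, 'k::field, nat, 'k) ainf_map" where
  "simplex_map m \<theta> = \<lparr>obj_map = restrict \<theta> {..m},
     hom_map = (\<lambda>as\<in>chains (ainf_simplex m). if length as = 1 then vec (hd as) else 0)\<rparr>"

definition nerve_simplices ::
  "('k::field, 'o, 'v::ab_group_add) ainf \<Rightarrow> nat \<Rightarrow> (nat, 'k, 'o, 'v) ainf_map set" where
  "nerve_simplices A n = {f. ainf_functor (ainf_simplex n) A f}"

text \<open>A morphism from \<^verbatim>\<open>n\<close> to \<^verbatim>\<open>m\<close> in the opposite category is a monotone map
  \<^verbatim>\<open>\<theta>\<close> from \<^verbatim>\<open>{..m}\<close> to \<^verbatim>\<open>{..n}\<close>.\<close>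

definition nerve ::
  "('k::field, 'o, 'v::ab_group_add) ainf \<Rightarrow> (nat, 'k, 'o, 'v) ainf_map sset" where
  "nerve A = \<lparr>on_ob = nerve_simplices A,
     on_hom = (\<lambda>n m \<theta>. \<lambda>f\<in>nerve_simplices A n. ainf_comp (ainf_simplex m) f (simplex_map m \<theta>))\<rparr>"

definition nerve_push ::
  "('k::field, 'o, 'v::ab_group_add) ainf \<Rightarrow> ('k, 'o, 'v) ainf \<Rightarrow> ('o, 'v, 'o, 'v) ainf_map
    \<Rightarrow> nat \<Rightarrow> (nat, 'k, 'o, 'v) ainf_map \<Rightarrow> (nat, 'k, 'o, 'v) ainf_map" where
  "nerve_push A B g = (\<lambda>n. \<lambda>f\<in>nerve_simplices A n. ainf_comp (ainf_simplex n) g f)"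

end

theory Submission
  imports Defs
begin

text \<open>
  The statement comes down to two facts: A-infinity functors can be composed, and the standard
  simplices form a cosimplicial object for this composition.  Granted these, everything about the
  nerve is associativity of composition: precomposing with a composite of simplex maps makes the
  nerve of \<^verbatim>\<open>A\<close> a simplicial set, the commutation of precomposition with
  postcomposition makes \<^verbatim>\<open>nerve_push\<close> natural, and postcomposing with a composite
  makes it functorial.

  Composition is handled by the bar construction.  Multiplying a function of a tensor
  \<^verbatim>\<open>[a\<^sub>n, ..., a\<^sub>1]\<close> by the sign that suspends every factor (\<^verbatim>\<open>susp\<close>)
  removes all signs from \<^verbatim>\<open>block_sum\<close> (\<^verbatim>\<open>susp_block_sum\<close>) and leaves in
  \<^verbatim>\<open>insertion_sum\<close> only the Koszul sign of an operator of degree 1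
  (\<^verbatim>\<open>susp_insertion_sum\<close>).  After that, a family of maps \<^verbatim>\<open>f\<^sub>n\<close>
  is a map of tensor coalgebras, which sends a tensor to the sum, over all ways of cutting it into
  blocks, of the tensors obtained by applying the family to each block; the relations of an
  A-infinity functor say that this map commutes with the bar differentials.

  Two combinatorial facts about lists then suffice.  Cutting a list and afterwards grouping the
  blocks is the same as cutting coarsely and refining each block (\<^verbatim>\<open>sum_cuts_refine\<close>);
  together with multilinearity this shows that composition of families is composition of coalgebra
  maps (\<^verbatim>\<open>sum_cuts_bar_map_ainf_comp\<close>), hence associative.  And a cut of a list in
  which one segment has been contracted to a single entry has exactly one block containing that
  entry (\<^verbatim>\<open>sum_splits_cuts_around\<close>), which lets the relation of a functor be applied
  inside this block, so that the coalgebra map commutes with the differentials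
  (\<^verbatim>\<open>bar_map_chain_map\<close>).  For a composite, the differential thus passes through
  the inner functor, and then through the outer one by its own relations
  (\<^verbatim>\<open>ainf_functor_ainf_comp\<close>).

  Identities and simplex maps are strict functors: all their higher components vanish and the
  first one does not change the underlying vectors.  For these only the cut into singletons
  contributes to a composite (\<^verbatim>\<open>block_sum_strict\<close>), so that precomposing with one merely
  relabels objects.
\<close>

section \<open>Suspension signs\<close>

lemma sgn_pow_cong: "even (e - e') \<Longrightarrow> sgn_pow e v = sgn_pow e' v"
  by (auto simp: sgn_pow_def)

lemma sgn_pow_add: "sgn_pow (a + b) v = sgn_pow a (sgn_pow b v)"
  by (auto simp: sgn_pow_def)

lemma sgn_pow_0 [simp]: "sgn_pow 0 v = v" "sgn_pow e 0 = 0"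
  by (auto simp: sgn_pow_def)

lemma sgn_pow_plus: "sgn_pow e (u + v) = sgn_pow e u + sgn_pow e v"
  by (auto simp: sgn_pow_def)

lemma sgn_pow_sum: "sgn_pow e (sum f S) = (\<Sum>x\<in>S. sgn_pow e (f x))"
  by (auto simp: sgn_pow_def sum_negf)

lemma sgn_pow_cancel [simp]: "sgn_pow e (sgn_pow e v) = v"
  by (auto simp: sgn_pow_def)

lemma degs_simps [simp]: "degs [] = 0" "degs (a # as) = deg a + degs as"
    "degs (as @ bs) = degs as + degs bs"
  by (auto simp: degs_def)

text \<open>
  The total degree after suspension, up to parity: suspending shifts the degree of each factor
  by 1.
\<close>
definition sdeg :: "('o, 'v) arr list \<Rightarrow> int" where
  "sdeg as = degs as + int (length as)"

lemma sdeg_simps [simp]: "sdeg [] = 0" "sdeg (a # as) = deg a + 1 + sdeg as"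
    "sdeg (as @ bs) = sdeg as + sdeg bs"
  by (auto simp: sdeg_def)

text \<open>
  The Koszul sign exponent for suspending all factors of a tensor at once: each suspension, of
  odd degree, is moved past the factors to its left, so every factor of suspended degree
  \<^verbatim>\<open>d\<close> contributes \<^verbatim>\<open>d\<close> once for every factor to its right.
\<close>
primrec susp_exp :: "('o, 'v) arr list \<Rightarrow> int" where
  "susp_exp [] = 0"
| "susp_exp (a # as) = int (length as) * (deg a + 1) + susp_exp as"

lemma susp_exp_append:
  "susp_exp (xs @ ys) = susp_exp xs + int (length ys) * sdeg xs + susp_exp ys"
  by (induction xs) (auto simp: algebra_simps)

lemma susp_exp_cong: "map deg as = map deg bs \<Longrightarrow> susp_exp as = susp_exp bs"
proof (induction as arbitrary: bs)
  case (Cons a as)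
  then obtain b bs' where "bs = b # bs'" "deg a = deg b" "map deg as = map deg bs'"
    by auto
  with Cons.IH[of bs'] map_eq_imp_length_eq[of deg as deg bs'] show ?case by simp
qed simp

definition susp :: "(('o, 'v) arr list \<Rightarrow> 'w::ab_group_add) \<Rightarrow> ('o, 'v) arr list \<Rightarrow> 'w" where
  "susp F as = sgn_pow (susp_exp as) (F as)"

lemma susp_inject: "susp F as = susp G as \<Longrightarrow> F as = G as"
  by (metis susp_def sgn_pow_cancel)

section \<open>Cutting lists into blocks\<close>

definition cuts :: "'a list \<Rightarrow> 'a list list set" where
  "cuts as = {bss. concat bss = as \<and> [] \<notin> set bss}"

definition splits :: "'a list \<Rightarrow> ('a list \<times> 'a list \<times> 'a list) set" where
  "splits as = {(xs, ys, zs). xs @ ys @ zs = as \<and> ys \<noteq> []}"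

text \<open>
  The cuts of \<^verbatim>\<open>xs @ b # zs\<close>, recorded without \<^verbatim>\<open>b\<close>: the block
  containing it is \<^verbatim>\<open>p @ b # q\<close>.
\<close>
definition cuts_around :: "'a list \<Rightarrow> 'a list \<Rightarrow> ('a list list \<times> 'a list \<times> 'a list \<times> 'a list list) set"
  where "cuts_around xs zs = {(xss, p, q, zss). concat xss @ p = xs \<and> q @ concat zss = zs \<and>
     [] \<notin> set xss \<and> [] \<notin> set zss}"

text \<open>
  Cuts with one distinguished block.  The two double sums that express that a coalgebra map
  commutes with the differentials are both regrouped over this set.
\<close>
definition marked_cuts :: "'a list \<Rightarrow> ('a list list \<times> 'a list \<times> 'a list list) set" where
  "marked_cuts as = {(xss, us, zss). concat xss @ us @ concat zss = as \<and> us \<noteq> [] \<and>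
     [] \<notin> set xss \<and> [] \<notin> set zss}"

lemma concat_eq_Nil_iff: "[] \<notin> set bss \<Longrightarrow> concat bss = [] \<longleftrightarrow> bss = []"
  by (cases bss) auto

lemma length_le_length_concat: "[] \<notin> set bss \<Longrightarrow> length bss \<le> length (concat bss)"
proof (induction bss)
  case (Cons bs bss)
  then show ?case by (cases bs) auto
qed simp

lemma finite_cuts [simp]: "finite (cuts as)"
proof (rule finite_subset)
  let ?B = "{bs. set bs \<subseteq> set as \<and> length bs \<le> length as}"
  show "cuts as \<subseteq> {bss. set bss \<subseteq> ?B \<and> length bss \<le> length as}"
    using length_le_length_concat
    by (fastforce simp: cuts_def length_concat intro: member_le_sum_list)
  show "finite {bss. set bss \<subseteq> ?B \<and> length bss \<le> length as}"
    by (intro finite_lists_length_le) simp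
qed

lemma finite_splits [simp]: "finite (splits as)"
proof (rule finite_subset)
  let ?h = "\<lambda>(i, j). (take i as, take j (drop i as), drop j (drop i as))"
  show "splits as \<subseteq> ?h ` ({..length as} \<times> {..length as})"
  proof clarify
    fix xs ys zs assume "(xs, ys, zs) \<in> splits as"
    then have "(xs, ys, zs) = ?h (length xs, length ys)"
      and "(length xs, length ys) \<in> {..length as} \<times> {..length as}"
      by (auto simp: splits_def)
    then show "(xs, ys, zs) \<in> ?h ` ({..length as} \<times> {..length as})" by (rule image_eqI)
  qed
qed simp

lemma listset_map_cuts:
  "csss \<in> listset (map cuts bss) \<longleftrightarrow> map concat csss = bss \<and> (\<forall>css\<in>set csss. [] \<notin> set css)"
proof (induction bss arbitrary: csss)
  case (Cons bs bss)
  then show ?case by (cases csss) (auto simp: set_Cons_def cuts_def)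
qed auto

lemma finite_listset: "(\<And>S. S \<in> set Ss \<Longrightarrow> finite S) \<Longrightarrow> finite (listset Ss)"
proof (induction Ss)
  case (Cons S Ss)
  have "set_Cons S (listset Ss) = (\<lambda>(c, cs). c # cs) ` (S \<times> listset Ss)"
    by (auto simp: set_Cons_def)
  with Cons show ?case by simp
qed simp

lemma sum_listset_Cons:
  "(\<Sum>cs\<in>listset (S # Ss). K cs) = (\<Sum>c\<in>S. \<Sum>cs\<in>listset Ss. K (c # cs))"
proof -
  have "(\<Sum>cs\<in>listset (S # Ss). K cs) = (\<Sum>(c, cs)\<in>S \<times> listset Ss. K (c # cs))"
    by (rule sum.reindex_bij_witness[of _ "\<lambda>(c, cs). c # cs" "\<lambda>cs. (hd cs, tl cs)"])
      (auto simp: set_Cons_def)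
  then show ?thesis by (simp add: sum.cartesian_product)
qed

lemma concat_concat: "concat (concat csss) = concat (map concat csss)"
  by (induction csss) auto

text \<open>
  Both sides run over the lists of lists of nonempty blocks that flatten to \<^verbatim>\<open>as\<close>.  The
  left side records the coarse cut \<^verbatim>\<open>map concat csss\<close>, the right side the fine cut
  \<^verbatim>\<open>concat csss\<close>.  This is the associativity of composition without its linear
  algebra.
\<close>
lemma sum_cuts_refine:
  "(\<Sum>bss\<in>cuts as. \<Sum>csss\<in>listset (map cuts bss). K csss)
    = (\<Sum>css\<in>cuts as. \<Sum>csss\<in>cuts css. K csss)"
proof -
  have "(\<Sum>(bss, csss)\<in>Sigma (cuts as) (\<lambda>bss. listset (map cuts bss)). K csss)
      = (\<Sum>(css, csss)\<in>Sigma (cuts as) cuts. K csss)"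
    by (rule sum.reindex_bij_witness[of _ "\<lambda>(css, csss). (map concat csss, csss)"
          "\<lambda>(bss, csss). (concat csss, csss)"])
      (auto simp: listset_map_cuts cuts_def concat_concat concat_eq_Nil_iff
          simp del: map_map concat_eq_Nil_conv Nil_eq_concat_conv;
        metis concat.simps(1) imageI concat_eq_Nil_iff)+
  then show ?thesis
    by (subst (1 2) sum.Sigma) (auto intro!: finite_listset)
qed

lemma concat_eq_map_conv:
  "concat dss = map \<phi> as \<Longrightarrow> \<exists>ess. dss = map (map \<phi>) ess \<and> concat ess = as"
proof (induction dss arbitrary: as)
  case (Cons ds dss)
  then obtain us vs where "as = us @ vs" "ds = map \<phi> us" "concat dss = map \<phi> vs"
    by (auto simp: append_eq_map_conv)
  with Cons.IH[of vs] obtain ess where "dss = map (map \<phi>) ess" "concat ess = vs" by auto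
  with \<open>as = us @ vs\<close> \<open>ds = map \<phi> us\<close> show ?case by (intro exI[of _ "us # ess"]) auto
qed auto

lemma map_map_inject_concat:
  "map (map \<phi>) css = map (map \<phi>) ess \<Longrightarrow> concat css = concat ess \<Longrightarrow> css = ess"
proof (induction css arbitrary: ess)
  case (Cons cs css)
  then obtain es ess' where ess: "ess = es # ess'" "map \<phi> cs = map \<phi> es"
      "map (map \<phi>) css = map (map \<phi>) ess'" by auto
  then have "length cs = length es" by (metis length_map)
  with Cons ess show ?case by auto
qed auto

lemma sum_cuts_map:
  "(\<Sum>dss\<in>cuts (map \<phi> as). K dss) = (\<Sum>bss\<in>cuts as. K (map (map \<phi>) bss))"
proof -
  have "cuts (map \<phi> as) = map (map \<phi>) ` cuts as"
    by (auto simp: cuts_def image_iff map_concat dest!: concat_eq_map_conv)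
  moreover have "inj_on (map (map \<phi>)) (cuts as)"
    by (auto simp: inj_on_def cuts_def intro: map_map_inject_concat)
  ultimately show ?thesis by (simp add: sum.reindex)
qed

lemma sum_splits_map:
  "(\<Sum>(xs, ys, zs)\<in>splits (map \<phi> as). K xs ys zs)
    = (\<Sum>(xs, ys, zs)\<in>splits as. K (map \<phi> xs) (map \<phi> ys) (map \<phi> zs))"
proof -
  let ?m = "\<lambda>(xs, ys, zs). (map \<phi> xs, map \<phi> ys, map \<phi> zs)"
  have "splits (map \<phi> as) = ?m ` splits as"
  proof (intro equalityI subsetI; clarsimp simp: splits_def)
    fix xs ys zs assume "xs @ ys @ zs = map \<phi> as" "ys \<noteq> []"
    then show "(xs, ys, zs) \<in> ?m ` {(xs, ys, zs). xs @ ys @ zs = as \<and> ys \<noteq> []}"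
      by (auto simp: append_eq_map_conv intro!: image_eqI)
  qed
  moreover have "inj_on ?m (splits as)"
    by (auto simp: inj_on_def splits_def) (metis append_eq_append_conv length_map)+
  ultimately show ?thesis by (simp add: sum.reindex case_prod_unfold)
qed

lemma concat_eq_append_Cons:
  "concat bss = xs @ b # zs \<Longrightarrow>
    \<exists>xss p q zss. bss = xss @ [p @ b # q] @ zss \<and> concat xss @ p = xs \<and> q @ concat zss = zs"
proof (induction bss arbitrary: xs)
  case (Cons bs bss)
  then have "bs @ concat bss = xs @ b # zs" by simp
  then consider us where "xs = bs @ us" "concat bss = us @ b # zs"
    | us where "bs = xs @ b # us" "us @ concat bss = zs"
    by (auto simp: append_eq_append_conv2 Cons_eq_append_conv append_eq_Cons_conv)
  then show ?case
  proof cases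
    case 1
    with Cons.IH[of us] obtain xss p q zss where
      "bss = xss @ [p @ b # q] @ zss" "concat xss @ p = us" "q @ concat zss = zs" by auto
    with 1 show ?thesis
      by (intro exI[of _ "bs # xss"] exI[of _ p] exI[of _ q] exI[of _ zss]) auto
  next
    case (2 us)
    then show ?thesis
      by (intro exI[of _ "[]"] exI[of _ xs] exI[of _ us] exI[of _ bss]) auto
  qed
qed simp

text \<open>
  The position of the block that contains \<^verbatim>\<open>b\<close> is determined by the cut, even if
  \<^verbatim>\<open>b\<close> occurs several times in the list: placing it further to the right would put
  more than \<^verbatim>\<open>length xs\<close> entries in front of it.
\<close>
lemma inj_on_cuts_around:
  "inj_on (\<lambda>(xss, p, q, zss). xss @ [p @ b # q] @ zss) (cuts_around xs zs)"
proof -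
  have le: "length xss' \<le> length xss"
    if eq: "xss @ [p @ b # q] @ zss = xss' @ [p' @ b # q'] @ zss'"
      and c: "concat xss @ p = concat xss' @ p'" for xss p q zss xss' p' q' zss'
  proof (rule ccontr)
    assume "\<not> length xss' \<le> length xss"
    with eq obtain us where "xss' = xss @ (p @ b # q) # us"
      by (auto simp: append_eq_append_conv2 Cons_eq_append_conv append_eq_Cons_conv)
    with c have "length (concat xss @ p) \<ge> length (concat xss) + length p + 1" by simp
    then show False by simp
  qed
  have "(xss, p, q, zss) = (xss', p', q', zss')"
    if "(xss, p, q, zss) \<in> cuts_around xs zs" "(xss', p', q', zss') \<in> cuts_around xs zs"
      and eq: "xss @ [p @ b # q] @ zss = xss' @ [p' @ b # q'] @ zss'"
    for xss p q zss xss' p' q' zss'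
  proof -
    from that have c: "concat xss @ p = concat xss' @ p'"
      by (auto simp: cuts_around_def)
    from le[OF eq c] le[OF eq[symmetric] c[symmetric]] have "length xss = length xss'" by simp
    with eq have "xss = xss'" "p @ b # q = p' @ b # q'" "zss = zss'" by auto
    moreover with c have "p = p'" by simp
    ultimately show ?thesis by simp
  qed
  then show ?thesis by (auto intro!: inj_onI)
qed

lemma cuts_append_Cons:
  "cuts (xs @ b # zs) = (\<lambda>(xss, p, q, zss). xss @ [p @ b # q] @ zss) ` cuts_around xs zs"
proof (intro equalityI subsetI)
  fix bss assume "bss \<in> cuts (xs @ b # zs)"
  then have "concat bss = xs @ b # zs" and ne: "[] \<notin> set bss" by (auto simp: cuts_def)
  from concat_eq_append_Cons[OF this(1)] obtain xss p q zss where
    "bss = xss @ [p @ b # q] @ zss" "concat xss @ p = xs" "q @ concat zss = zs" by blast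
  with ne have "(xss, p, q, zss) \<in> cuts_around xs zs"
    and "bss = (\<lambda>(xss, p, q, zss). xss @ [p @ b # q] @ zss) (xss, p, q, zss)"
    by (auto simp: cuts_around_def)
  then show "bss \<in> (\<lambda>(xss, p, q, zss). xss @ [p @ b # q] @ zss) ` cuts_around xs zs" by blast
qed (auto simp: cuts_def cuts_around_def)

lemma sum_cuts_append_Cons:
  "(\<Sum>bss\<in>cuts (xs @ b # zs). G bss)
    = (\<Sum>(xss, p, q, zss)\<in>cuts_around xs zs. G (xss @ [p @ b # q] @ zss))"
  by (simp only: cuts_append_Cons sum.reindex[OF inj_on_cuts_around]) (simp add: case_prod_unfold)

lemma finite_cuts_around [simp]: "finite (cuts_around xs zs)"
  by (rule finite_imageD[OF _ inj_on_cuts_around[of undefined]])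
    (metis (no_types) cuts_append_Cons finite_cuts)

lemma finite_marked_cuts [simp]: "finite (marked_cuts as)"
proof (rule finite_subset)
  let ?h = "\<lambda>(css, xss, yss, zss). (xss, hd yss, zss)"
  show "marked_cuts as \<subseteq> ?h ` Sigma (cuts as) splits"
  proof clarify
    fix xss us zss assume "(xss, us, zss) \<in> marked_cuts as"
    then have "(xss @ [us] @ zss, xss, [us], zss) \<in> Sigma (cuts as) splits"
      by (auto simp: marked_cuts_def cuts_def splits_def)
    then show "(xss, us, zss) \<in> ?h ` Sigma (cuts as) splits" by (rule rev_image_eqI) simp
  qed
qed simp

text \<open>
  Choosing a segment of consecutive blocks amounts to merging them into one distinguished block
  and recutting that block.
\<close>
lemma sum_cuts_splits:
  "(\<Sum>css\<in>cuts as. \<Sum>(xss, yss, zss)\<in>splits css. K xss yss zss)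
    = (\<Sum>(xss, us, zss)\<in>marked_cuts as. \<Sum>yss\<in>cuts us. K xss yss zss)"
proof -
  have "(\<Sum>(css, xss, yss, zss)\<in>Sigma (cuts as) splits. K xss yss zss)
     = (\<Sum>((xss, us, zss), yss)\<in>Sigma (marked_cuts as) (\<lambda>(xss, us, zss). cuts us). K xss yss zss)"
    by (rule sum.reindex_bij_witness[of _
          "\<lambda>((xss, us, zss), yss). (xss @ yss @ zss, xss, yss, zss)"
          "\<lambda>(css, xss, yss, zss). ((xss, concat yss, zss), yss)"])
      (auto simp: marked_cuts_def cuts_def splits_def concat_eq_Nil_iff simp del: concat_eq_Nil_conv)
  then show ?thesis
    by (subst (asm) (1 2) sum.Sigma[symmetric]) (auto simp: case_prod_unfold)
qed

text \<open>
  On the left, a segment \<^verbatim>\<open>ys\<close> is contracted to one entry and the result is cut into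
  blocks; on the right, the list is cut first, and the segment is chosen inside the distinguished
  block.
\<close>
lemma sum_splits_cuts_around:
  "(\<Sum>(xs, ys, zs)\<in>splits as. \<Sum>(xss, p, q, zss)\<in>cuts_around xs zs. K xss p ys q zss)
    = (\<Sum>(xss, us, zss)\<in>marked_cuts as. \<Sum>(p, ys, q)\<in>splits us. K xss p ys q zss)"
proof -
  have "(\<Sum>((xs, ys, zs), (xss, p, q, zss))\<in>Sigma (splits as) (\<lambda>(xs, ys, zs). cuts_around xs zs).
        K xss p ys q zss)
     = (\<Sum>((xss, us, zss), (p, ys, q))\<in>Sigma (marked_cuts as) (\<lambda>(xss, us, zss). splits us).
        K xss p ys q zss)"
    by (rule sum.reindex_bij_witness[of _
          "\<lambda>((xss, us, zss), (p, ys, q)). ((concat xss @ p, ys, q @ concat zss), (xss, p, q, zss))"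
          "\<lambda>((xs, ys, zs), (xss, p, q, zss)). ((xss, p @ ys @ q, zss), (p, ys, q))"])
      (auto simp: marked_cuts_def cuts_around_def splits_def)
  then show ?thesis
    by (subst (asm) (1 2) sum.Sigma[symmetric]) (auto simp: case_prod_unfold)
qed

section \<open>Additive functions on chains\<close>

context ainf_category
begin

lemma homs_add: "\<lbrakk>x \<in> objs A; y \<in> objs A; u \<in> homs A x y d; v \<in> homs A x y d\<rbrakk> \<Longrightarrow> u + v \<in> homs A x y d"
  using subspace_add[OF homs_subspace] by blast

lemma homs_0: "\<lbrakk>x \<in> objs A; y \<in> objs A\<rbrakk> \<Longrightarrow> 0 \<in> homs A x y d"
  using subspace_0[OF homs_subspace] by blast

lemma homs_scl: "\<lbrakk>x \<in> objs A; y \<in> objs A; u \<in> homs A x y d\<rbrakk> \<Longrightarrow> scl A c u \<in> homs A x y d"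
  using subspace_scale[OF homs_subspace] by blast

lemma homs_sgn_pow: "\<lbrakk>x \<in> objs A; y \<in> objs A; u \<in> homs A x y d\<rbrakk> \<Longrightarrow> sgn_pow e u \<in> homs A x y d"
  using subspace_neg[OF homs_subspace] by (auto simp: sgn_pow_def)

lemma homs_sum:
  "\<lbrakk>x \<in> objs A; y \<in> objs A; \<And>c. c \<in> S \<Longrightarrow> v c \<in> homs A x y d\<rbrakk> \<Longrightarrow> (\<Sum>c\<in>S. v c) \<in> homs A x y d"
  using subspace_sum[OF homs_subspace] by blast

end

lemma Arr_in_arrows [simp]:
  "Arr x y d v \<in> arrows A \<longleftrightarrow> x \<in> objs A \<and> y \<in> objs A \<and> v \<in> homs A x y d"
  by (auto simp: arrows_def)

lemma chains_not_Nil: "as \<in> chains A \<Longrightarrow> as \<noteq> []"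
  by (auto simp: chains_def)

lemma singleton_in_chains [simp]: "[a] \<in> chains A \<longleftrightarrow> a \<in> arrows A"
  by (auto simp: chains_def)

lemma append_in_chains:
  "xs \<noteq> [] \<Longrightarrow> ys \<noteq> [] \<Longrightarrow>
    xs @ ys \<in> chains A \<longleftrightarrow> xs \<in> chains A \<and> ys \<in> chains A \<and> src (last xs) = tgt (hd ys)"
  by (auto simp: chains_def successively_append_iff)

lemma chains_middle: "xs @ ys @ zs \<in> chains A \<Longrightarrow> ys \<noteq> [] \<Longrightarrow> ys \<in> chains A"
  by (auto simp: chains_def successively_append_iff)

lemma chains_src_tgt:
  "as \<in> chains A \<Longrightarrow> src (last as) \<in> objs A" "as \<in> chains A \<Longrightarrow> tgt (hd as) \<in> objs A"
  by (cases as rule: rev_cases; force simp: chains_def arrows_def)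
     (cases as; force simp: chains_def arrows_def)

lemma chains_replace:
  assumes "xs @ ys @ zs \<in> chains A" "ys \<noteq> []" "b \<in> arrows A"
    and "src b = src (last ys)" "tgt b = tgt (hd ys)"
  shows "xs @ b # zs \<in> chains A"
  using assms by (cases "zs = []") (auto simp: chains_def successively_append_iff successively_Cons)

lemma chains_replace1:
  "\<lbrakk>xs @ a # zs \<in> chains A; b \<in> arrows A; src b = src a; tgt b = tgt a\<rbrakk> \<Longrightarrow> xs @ b # zs \<in> chains A"
  using chains_replace[of xs "[a]" zs A b] by simp

lemma chains_replace_vec:
  "\<lbrakk>xs @ Arr x y d u # zs \<in> chains A; v \<in> homs A x y e\<rbrakk> \<Longrightarrow> xs @ Arr x y e v # zs \<in> chains A"
  by (rule chains_replace1) (auto simp: chains_def)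

text \<open>
  Sums and signs are the linear operations of the bar construction, and additivity in each factor
  moves both of them out of a tensor.
\<close>
definition additive_on_chains ::
  "('k, 'o, 'v::ab_group_add) ainf \<Rightarrow> (('o, 'v) arr list \<Rightarrow> 'w::ab_group_add) \<Rightarrow> bool" where
  "additive_on_chains A F \<longleftrightarrow> (\<forall>as bs x y d u v. as @ Arr x y d u # bs \<in> chains A \<longrightarrow>
     v \<in> homs A x y d \<longrightarrow>
     F (as @ Arr x y d (u + v) # bs) = F (as @ Arr x y d u # bs) + F (as @ Arr x y d v # bs))"

lemma multilinear_imp_additive: "multilinear A s F \<Longrightarrow> additive_on_chains A F"
  by (auto simp: multilinear_def additive_on_chains_def)

lemma multilinear_scale:
  "multilinear A s F \<Longrightarrow> as @ Arr x y d u # bs \<in> chains A \<Longrightarrow>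
     F (as @ Arr x y d (scl A c u) # bs) = s c (F (as @ Arr x y d u # bs))"
  unfolding multilinear_def by (elim allE[of _ as] allE[of _ bs] allE[of _ x] allE[of _ y]
      allE[of _ d] allE[of _ u] allE[of _ c]) (auto simp: chains_def)

lemma multilinearI:
  assumes "\<And>as bs x y d u v. \<lbrakk>as @ Arr x y d u # bs \<in> chains A; v \<in> homs A x y d\<rbrakk> \<Longrightarrow>
     F (as @ Arr x y d (u + v) # bs) = F (as @ Arr x y d u # bs) + F (as @ Arr x y d v # bs)"
    and "\<And>as bs x y d u c. as @ Arr x y d u # bs \<in> chains A \<Longrightarrow>
     F (as @ Arr x y d (scl A c u) # bs) = s c (F (as @ Arr x y d u # bs))"
  shows "multilinear A s F"
  using assms by (auto simp: multilinear_def)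

lemma additive_plus:
  "\<lbrakk>additive_on_chains A F; as @ Arr x y d u # bs \<in> chains A; v \<in> homs A x y d\<rbrakk> \<Longrightarrow>
     F (as @ Arr x y d (u + v) # bs) = F (as @ Arr x y d u # bs) + F (as @ Arr x y d v # bs)"
  by (auto simp: additive_on_chains_def)

lemma additive_0:
  assumes "ainf_category A" "additive_on_chains A F" "as @ Arr x y d u # bs \<in> chains A"
  shows "F (as @ Arr x y d 0 # bs) = 0"
proof -
  interpret ainf_category A by fact
  have "0 \<in> homs A x y d" using assms(3) by (intro homs_0) (auto simp: chains_def)
  with additive_plus[OF assms(2) chains_replace_vec[OF assms(3) this] this] show ?thesis by simp
qed

lemma additive_vec_0:
  assumes "ainf_category A" "additive_on_chains A F" "as \<in> chains A" "a \<in> set as" "vec a = 0"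
  shows "F as = 0"
proof -
  obtain xs ys where "as = xs @ a # ys" using split_list[OF assms(4)] by blast
  moreover obtain x y d where "a = Arr x y d 0" using assms(5) by (cases a) auto
  ultimately show ?thesis using additive_0[OF assms(1,2)] assms(3) by metis
qed

lemma additive_sgn_pow:
  assumes "ainf_category A" "additive_on_chains A F" "as @ Arr x y d u # bs \<in> chains A"
  shows "F (as @ Arr x y d (sgn_pow e u) # bs) = sgn_pow e (F (as @ Arr x y d u # bs))"
proof -
  interpret ainf_category A by fact
  have obj: "x \<in> objs A" "y \<in> objs A" "u \<in> homs A x y d"
    using assms(3) by (auto simp: chains_def)
  have "- u \<in> homs A x y d" using homs_sgn_pow[OF obj, of 1] by (simp add: sgn_pow_def)
  then have "F (as @ Arr x y d (u + - u) # bs)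
      = F (as @ Arr x y d u # bs) + F (as @ Arr x y d (- u) # bs)"
    by (rule additive_plus[OF assms(2,3)])
  with additive_0[OF assms] have "F (as @ Arr x y d (- u) # bs) = - F (as @ Arr x y d u # bs)"
    by (simp add: eq_neg_iff_add_eq_0 add.commute)
  then show ?thesis by (simp add: sgn_pow_def)
qed

lemma additive_sum:
  assumes "ainf_category A" "additive_on_chains A F" "as @ Arr x y d u # bs \<in> chains A"
    and "finite S" "\<And>c. c \<in> S \<Longrightarrow> v c \<in> homs A x y d"
  shows "F (as @ Arr x y d (\<Sum>c\<in>S. v c) # bs) = (\<Sum>c\<in>S. F (as @ Arr x y d (v c) # bs))"
proof -
  interpret ainf_category A by fact
  have obj: "x \<in> objs A" "y \<in> objs A" using assms(3) by (auto simp: chains_def)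
  from assms(4,5) show ?thesis
  proof (induction S)
    case empty
    show ?case using additive_0[OF assms(1-3)] by simp
  next
    case (insert c S)
    have "(\<Sum>c\<in>S. v c) \<in> homs A x y d" using insert obj by (intro homs_sum) auto
    with additive_plus[OF assms(2) chains_replace_vec[OF assms(3)], of "v c" d "\<Sum>c\<in>S. v c"] insert
    show ?case by simp
  qed
qed

lemma arr_eqI: "\<lbrakk>src a = src b; tgt a = tgt b; deg a = deg b; vec a = vec b\<rbrakk> \<Longrightarrow> a = b"
  by (cases a; cases b) auto

text \<open>
  Expanding a product of sums: if the vector of each factor \<^verbatim>\<open>\<alpha> i\<close> is a sum over
  \<^verbatim>\<open>S i\<close>, then the value is a sum over all choices of one summand for each factor.
  The prefix \<^verbatim>\<open>xs\<close> of factors already expanded carries the induction.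
\<close>
lemma additive_expand:
  assumes "ainf_category A" "additive_on_chains A F"
    and "xs @ map \<alpha> is \<in> chains A"
    and "\<And>i. i \<in> set is \<Longrightarrow> finite (S i)"
    and "\<And>i. i \<in> set is \<Longrightarrow> vec (\<alpha> i) = (\<Sum>c\<in>S i. vec (\<phi> c))"
    and "\<And>i c. \<lbrakk>i \<in> set is; c \<in> S i\<rbrakk> \<Longrightarrow> \<phi> c \<in> arrows A \<and>
      src (\<phi> c) = src (\<alpha> i) \<and> tgt (\<phi> c) = tgt (\<alpha> i) \<and> deg (\<phi> c) = deg (\<alpha> i)"
  shows "F (xs @ map \<alpha> is) = (\<Sum>cs\<in>listset (map S is). F (xs @ map \<phi> cs))"
  using assms(3-6)
proof (induction "is" arbitrary: xs)
  case (Cons i "is")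
  have \<phi>: "\<phi> c \<in> arrows A" "\<phi> c = Arr (src (\<alpha> i)) (tgt (\<alpha> i)) (deg (\<alpha> i)) (vec (\<phi> c))" if "c \<in> S i" for c
    using Cons.prems(4)[of i c] that by (auto intro: arr_eqI)
  have chain: "xs @ Arr (src (\<alpha> i)) (tgt (\<alpha> i)) (deg (\<alpha> i)) (vec (\<alpha> i)) # map \<alpha> is \<in> chains A"
    using Cons.prems(1) by simp
  have \<phi>_chain: "(xs @ [\<phi> c]) @ map \<alpha> is \<in> chains A" if "c \<in> S i" for c
    using chains_replace1[of xs "\<alpha> i" "map \<alpha> is" A "\<phi> c"] Cons.prems(1)
      Cons.prems(4)[of i c] that by simp
  have "F (xs @ map \<alpha> (i # is))
      = F (xs @ Arr (src (\<alpha> i)) (tgt (\<alpha> i)) (deg (\<alpha> i)) (\<Sum>c\<in>S i. vec (\<phi> c)) # map \<alpha> is)"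
    using Cons.prems(3)[of i] by (simp flip: Cons.prems(3))
  also have "\<dots> = (\<Sum>c\<in>S i. F (xs @ Arr (src (\<alpha> i)) (tgt (\<alpha> i)) (deg (\<alpha> i)) (vec (\<phi> c)) # map \<alpha> is))"
    using \<phi> Cons.prems(2) by (intro additive_sum[OF assms(1,2) chain]) (auto, metis Arr_in_arrows)
  also have "\<dots> = (\<Sum>c\<in>S i. F ((xs @ [\<phi> c]) @ map \<alpha> is))"
    using \<phi>(2) by (intro sum.cong) auto
  also have "\<dots> = (\<Sum>c\<in>S i. \<Sum>cs\<in>listset (map S is). F ((xs @ [\<phi> c]) @ map \<phi> cs))"
    using Cons.prems(2-4) \<phi>_chain by (intro sum.cong refl Cons.IH) auto
  also have "\<dots> = (\<Sum>cs\<in>listset (map S (i # is)). F (xs @ map \<phi> cs))"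
    by (simp only: list.map sum_listset_Cons) simp
  finally show ?case .
qed simp

lemma additive_susp: "additive_on_chains A F \<Longrightarrow> additive_on_chains A (susp F)"
  by (auto simp: additive_on_chains_def susp_def sgn_pow_plus
      susp_exp_append)

lemma scale_sgn_pow: "vector_space s \<Longrightarrow> s c (sgn_pow e v) = sgn_pow e (s c v)"
  by (auto simp: sgn_pow_def module.scale_minus_right simp flip: module_iff_vector_space)

lemma multilinear_susp:
  assumes "multilinear A s F" "vector_space s"
  shows "multilinear A s (susp F)"
proof (rule multilinearI)
  show "susp F (as @ Arr x y d (u + v) # bs)
      = susp F (as @ Arr x y d u # bs) + susp F (as @ Arr x y d v # bs)"
    if "as @ Arr x y d u # bs \<in> chains A" "v \<in> homs A x y d" for as bs x y d u v
    using additive_plus[OF additive_susp[OF multilinear_imp_additive[OF assms(1)]] that] .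
  show "susp F (as @ Arr x y d (scl A c u) # bs) = s c (susp F (as @ Arr x y d u # bs))"
    if "as @ Arr x y d u # bs \<in> chains A" for as bs x y d u c
    using multilinear_scale[OF assms(1) that]
    by (simp add: susp_def scale_sgn_pow[OF assms(2)] susp_exp_append)
qed

lemma multilinear_cong:
  assumes "ainf_category A" "multilinear A s F" "\<And>as. as \<in> chains A \<Longrightarrow> F as = G as"
  shows "multilinear A s G"
proof -
  interpret ainf_category A by fact
  have in_homs: "x \<in> objs A \<and> y \<in> objs A \<and> u \<in> homs A x y d" if "as @ Arr x y d u # bs \<in> chains A"
    for as bs x y d u
    using that by (auto simp: chains_def)
  show ?thesis
  proof (rule multilinearI)
    fix as bs x y d u v
    assume c: "as @ Arr x y d u # bs \<in> chains A" and v: "v \<in> homs A x y d"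
    then have "as @ Arr x y d (u + v) # bs \<in> chains A" "as @ Arr x y d v # bs \<in> chains A"
      using in_homs[OF c] by (auto intro: chains_replace_vec[OF c] homs_add)
    with c additive_plus[OF multilinear_imp_additive[OF assms(2)] c v]
    show "G (as @ Arr x y d (u + v) # bs) = G (as @ Arr x y d u # bs) + G (as @ Arr x y d v # bs)"
      by (simp add: assms(3))
  next
    fix as bs x y d u c
    assume ch: "as @ Arr x y d u # bs \<in> chains A"
    then have "as @ Arr x y d (scl A c u) # bs \<in> chains A"
      using in_homs[OF ch] by (auto intro: chains_replace_vec[OF ch] homs_scl)
    with ch multilinear_scale[OF assms(2) ch, of c]
    show "G (as @ Arr x y d (scl A c u) # bs) = s c (G (as @ Arr x y d u # bs))"
      by (simp add: assms(3))
  qed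
qed

section \<open>The bar construction\<close>

text \<open>
  The values of the suspended operations and maps, as arrows.  Their recorded degree is the one
  before suspension, so they differ from \<^verbatim>\<open>mu_arr\<close> and \<^verbatim>\<open>map_arr\<close> by a
  sign only.
\<close>
definition bar_arr :: "('k, 'o, 'v::ab_group_add) ainf \<Rightarrow> ('o, 'v) arr list \<Rightarrow> ('o, 'v) arr" where
  "bar_arr A as = Arr (src (last as)) (tgt (hd as)) (degs as + 2 - int (length as)) (susp (mu A) as)"

definition bar_map ::
  "('o, 'v, 'p, 'w::ab_group_add) ainf_map \<Rightarrow> ('o, 'v) arr list \<Rightarrow> ('p, 'w) arr" where
  "bar_map f as = Arr (obj_map f (src (last as))) (obj_map f (tgt (hd as)))
     (degs as + 1 - int (length as)) (susp (hom_map f) as)"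

lemma bar_arr_sel [simp]:
  "src (bar_arr A as) = src (last as)" "tgt (bar_arr A as) = tgt (hd as)"
  "deg (bar_arr A as) = degs as + 2 - int (length as)" "vec (bar_arr A as) = susp (mu A) as"
  by (auto simp: bar_arr_def)

lemma mu_arr_sel [simp]:
  "src (mu_arr A as) = src (last as)" "tgt (mu_arr A as) = tgt (hd as)"
  "deg (mu_arr A as) = degs as + 2 - int (length as)" "vec (mu_arr A as) = mu A as"
  by (auto simp: mu_arr_def)

lemma bar_map_sel [simp]:
  "src (bar_map f as) = obj_map f (src (last as))" "tgt (bar_map f as) = obj_map f (tgt (hd as))"
  "deg (bar_map f as) = degs as + 1 - int (length as)" "vec (bar_map f as) = susp (hom_map f) as"
  by (auto simp: bar_map_def)

lemma map_arr_sel [simp]: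
  "src (map_arr f as) = obj_map f (src (last as))" "tgt (map_arr f as) = obj_map f (tgt (hd as))"
  "deg (map_arr f as) = degs as + 1 - int (length as)" "vec (map_arr f as) = hom_map f as"
  by (auto simp: map_arr_def)

text \<open>
  What is needed of a functor for its values on blocks to be composable arrows.  It is separated
  from the other properties of a functor because it must be known of a composite before its
  relations can be stated in the bar construction.
\<close>
definition graded_map ::
  "('k, 'o, 'v) ainf \<Rightarrow> ('k, 'p, 'w) ainf \<Rightarrow> ('o, 'v, 'p, 'w) ainf_map \<Rightarrow> bool" where
  "graded_map A B f \<longleftrightarrow> (\<forall>x\<in>objs A. obj_map f x \<in> objs B) \<and>
     (\<forall>as\<in>chains A. hom_map f as \<in> homs B (obj_map f (src (last as))) (obj_map f (tgt (hd as)))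
        (degs as + 1 - int (length as)))"

lemma (in ainf_functor) graded_map: "graded_map A B f"
  using obj_map_in hom_map_degree by (auto simp: graded_map_def)

lemma graded_map_objs:
  assumes "graded_map A B f" "as \<in> chains A"
  shows "obj_map f (src (last as)) \<in> objs B" "obj_map f (tgt (hd as)) \<in> objs B"
  using assms chains_src_tgt[of as A] by (auto simp: graded_map_def)

lemma map_arr_in_arrows: "graded_map A B f \<Longrightarrow> as \<in> chains A \<Longrightarrow> map_arr f as \<in> arrows B"
  using graded_map_objs[of A B f as] by (auto simp: graded_map_def arrows_def)

lemma bar_map_in_arrows:
  assumes "ainf_category B" "graded_map A B f" "as \<in> chains A"
  shows "bar_map f as \<in> arrows B"
proof -
  interpret ainf_category B by fact
  show ?thesis using graded_map_objs[OF assms(2,3)] assms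
    by (auto simp: arrows_def graded_map_def susp_def intro: homs_sgn_pow)
qed

context ainf_category
begin

lemma mu_arr_in_arrows: "as \<in> chains A \<Longrightarrow> mu_arr A as \<in> arrows A"
  using chains_src_tgt[of as A] mu_degree by (auto simp: arrows_def)

lemma bar_arr_in_arrows: "as \<in> chains A \<Longrightarrow> bar_arr A as \<in> arrows A"
  using chains_src_tgt[of as A] mu_degree by (auto simp: arrows_def susp_def intro: homs_sgn_pow)

lemma splits_in_chains:
  assumes "as \<in> chains A" "(xs, ys, zs) \<in> splits as"
  shows "ys \<in> chains A" "xs @ mu_arr A ys # zs \<in> chains A" "xs @ bar_arr A ys # zs \<in> chains A"
proof -
  from assms have as: "xs @ ys @ zs \<in> chains A" "ys \<noteq> []" by (auto simp: splits_def)
  show ys: "ys \<in> chains A" using chains_middle[OF as] .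
  show "xs @ mu_arr A ys # zs \<in> chains A" "xs @ bar_arr A ys # zs \<in> chains A"
    using chains_replace[OF as] mu_arr_in_arrows[OF ys] bar_arr_in_arrows[OF ys] by auto
qed

end

lemma block_in_chains:
  assumes "as \<in> chains A" "bss \<in> cuts as" "bs \<in> set bss"
  shows "bs \<in> chains A"
proof -
  from assms(3) obtain xss yss where "bss = xss @ bs # yss" by (auto dest: split_list)
  with assms show ?thesis
    using chains_middle[of "concat xss" bs "concat yss" A] by (auto simp: cuts_def)
qed

text \<open>
  Consecutive blocks meet in an object, and \<^verbatim>\<open>\<phi>\<close> changes the end points of blocks
  through one map \<^verbatim>\<open>ob\<close> of objects, so its values are again composable.
\<close>
lemma map_blocks_in_chains:
  assumes "as \<in> chains A" "bss \<in> cuts as"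
    and \<phi>: "\<And>bs. bs \<in> chains A \<Longrightarrow> \<phi> bs \<in> arrows B \<and> src (\<phi> bs) = ob (src (last bs))
      \<and> tgt (\<phi> bs) = ob (tgt (hd bs))"
  shows "map \<phi> bss \<in> chains B"
  using assms(1,2)
proof (induction bss arbitrary: as)
  case Nil
  then show ?case by (auto simp: cuts_def chains_def)
next
  case (Cons bs bss)
  show ?case
  proof (cases "bss = []")
    case True
    with Cons.prems \<phi> show ?thesis by (auto simp: cuts_def)
  next
    case False
    with Cons.prems have ne: "bs \<noteq> []" "concat bss \<noteq> []" "bss \<in> cuts (concat bss)"
      by (auto simp: cuts_def concat_eq_Nil_iff simp del: concat_eq_Nil_conv)
    with Cons.prems have "bs @ concat bss \<in> chains A" by (auto simp: cuts_def)
    with append_in_chains[OF ne(1,2)]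
    have ch: "bs \<in> chains A" "concat bss \<in> chains A" "src (last bs) = tgt (hd (concat bss))" by auto
    have "hd (concat bss) = hd (hd bss)" using False ne(3) by (cases bss) (auto simp: cuts_def hd_append)
    moreover have "hd bss \<in> chains A"
      using block_in_chains[OF ch(2) ne(3)] False by simp
    ultimately have "src (\<phi> bs) = tgt (hd (map \<phi> bss))" using \<phi> ch False by (simp add: hd_map)
    then show ?thesis
      using append_in_chains[of "[\<phi> bs]" "map \<phi> bss" B] Cons.IH[OF ch(2) ne(3)] \<phi>[OF ch(1)] False
      by simp
  qed
qed

lemma map_map_arr_in_chains:
  "\<lbrakk>graded_map A B f; as \<in> chains A; bss \<in> cuts as\<rbrakk> \<Longrightarrow> map (map_arr f) bss \<in> chains B"
  by (erule (1) map_blocks_in_chains[where ob = "obj_map f"]) (auto intro: map_arr_in_arrows)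

lemma map_bar_map_in_chains:
  "\<lbrakk>ainf_category B; graded_map A B f; as \<in> chains A; bss \<in> cuts as\<rbrakk>
    \<Longrightarrow> map (bar_map f) bss \<in> chains B"
  by (erule (1) map_blocks_in_chains[where ob = "obj_map f"]) (auto intro: bar_map_in_arrows)

lemma eps_snoc: "eps (is @ [i]) = eps is + (1 - int i) * int (sum_list is)"
proof (cases "is = []")
  case False
  then have "{1..<length (is @ [i])} = insert (length is) {1..<length is}" by (auto simp: Suc_le_eq)
  moreover have "(\<Sum>l<length is. int ((is @ [i]) ! l)) = int (sum_list is)"
    by (simp add: sum_list_sum_nth nth_append atLeast0LessThan)
  moreover have "(\<Sum>k = 1..<length is. (1 - int ((is @ [i]) ! k)) * (\<Sum>l<k. int ((is @ [i]) ! l)))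
      = eps is"
    unfolding eps_def by (intro sum.cong refl arg_cong2[where f = "(*)"]) (auto simp: nth_append)
  ultimately show ?thesis by (simp add: eps_def)
qed (simp add: eps_def)

lemma koszul_snoc:
  assumes "length gs = length ds"
  shows "koszul (gs @ [g]) (ds @ [d]) = koszul gs ds + g * sum_list ds"
proof -
  have "(\<Sum>l<length ds. (ds @ [d]) ! l) = sum_list ds"
    by (simp add: sum_list_sum_nth nth_append atLeast0LessThan)
  moreover have "(\<Sum>k<length gs. (gs @ [g]) ! k * (\<Sum>l<k. (ds @ [d]) ! l)) = koszul gs ds"
    unfolding koszul_def using assms
    by (intro sum.cong refl arg_cong2[where f = "(*)"]) (auto simp: nth_append)
  moreover have "(gs @ [g]) ! length ds = g" using assms by (metis nth_append_length)
  ultimately show ?thesis using assms by (simp add: koszul_def)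
qed

lemma sum_list_map_degs: "sum_list (map degs bss) = degs (concat bss)"
  by (induction bss) auto

text \<open>After suspension, the components of a functor have degree 0.\<close>
lemma even_sdeg_map_bar_map: "even (sdeg (map (bar_map f) bss) - sdeg (concat bss))"
  by (induction bss) (auto simp: sdeg_def)

text \<open>
  The sign in \<^verbatim>\<open>block_sum\<close> is the one by which the suspensions of the blocks and of their
  list of values differ from the suspension of the whole tensor.  A further block
  \<^verbatim>\<open>bs\<close> adds \<^verbatim>\<open>(1 - length bs) * sdeg (concat bss)\<close> to the exponents of
  \<^verbatim>\<open>block_sum\<close>, \<^verbatim>\<open>sdeg (concat bss)\<close> to the suspension of the values, and
  \<^verbatim>\<open>length bs * sdeg (concat bss)\<close> to the suspension of the tensor, besides
  \<^verbatim>\<open>susp_exp bs\<close> twice: an even number in total.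
\<close>
lemma even_block_sign:
  "even (eps (map length bss) + koszul (map (\<lambda>bs. 1 - int (length bs)) bss) (map degs bss)
     + susp_exp (map (bar_map f) bss) + (\<Sum>bs\<leftarrow>bss. susp_exp bs) + susp_exp (concat bss))"
proof (induction bss rule: rev_induct)
  case Nil
  show ?case by (simp add: eps_def koszul_def)
next
  case (snoc bs bss)
  have "int (sum_list (map length bss)) + sum_list (map degs bss) = sdeg (concat bss)"
    by (simp add: sdeg_def length_concat sum_list_map_degs)
  then have E: "eps (map length (bss @ [bs]))
      + koszul (map (\<lambda>bs. 1 - int (length bs)) (bss @ [bs])) (map degs (bss @ [bs]))
    = eps (map length bss) + koszul (map (\<lambda>bs. 1 - int (length bs)) bss) (map degs bss)
      + (1 - int (length bs)) * sdeg (concat bss)"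
    by (simp add: eps_snoc koszul_snoc flip: distrib_left)
  show ?case
    using snoc.IH even_sdeg_map_bar_map[of f bss] unfolding E
    by (simp add: susp_exp_append) blast
qed

text \<open>The suspension signs inside the factors can be pulled out by additivity.\<close>
lemma additive_map_bar_map:
  assumes "ainf_category B" "additive_on_chains B F" "graded_map A B f"
    and "\<And>bs. bs \<in> set bss \<Longrightarrow> bs \<in> chains A"
    and "xs @ map (map_arr f) bss \<in> chains B"
  shows "F (xs @ map (bar_map f) bss)
    = sgn_pow (\<Sum>bs\<leftarrow>bss. susp_exp bs) (F (xs @ map (map_arr f) bss))"
  using assms(4,5)
proof (induction bss arbitrary: xs)
  case (Cons bs bss)
  let ?x = "obj_map f (src (last bs))" and ?y = "obj_map f (tgt (hd bs))"
    and ?d = "degs bs + 1 - int (length bs)"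
  have "(xs @ [bar_map f bs]) @ map (map_arr f) bss \<in> chains B"
    using chains_replace1[of xs "map_arr f bs" "map (map_arr f) bss" B "bar_map f bs"] Cons.prems
      bar_map_in_arrows[OF assms(1,3), of bs] by simp
  with Cons have "F ((xs @ [bar_map f bs]) @ map (bar_map f) bss)
      = sgn_pow (\<Sum>bs\<leftarrow>bss. susp_exp bs) (F ((xs @ [bar_map f bs]) @ map (map_arr f) bss))"
    by (intro Cons.IH) auto
  moreover have "F (xs @ bar_map f bs # map (map_arr f) bss)
      = sgn_pow (susp_exp bs) (F (xs @ map_arr f bs # map (map_arr f) bss))"
    unfolding bar_map_def map_arr_def[of f bs] susp_def using Cons.prems(2)
    by (intro additive_sgn_pow[OF assms(1,2)]) (simp add: map_arr_def[of f bs])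
  ultimately show ?case by (simp add: add.commute flip: sgn_pow_add)
qed simp

lemma susp_block_sum:
  fixes f :: "('o, 'v, 'p, 'w::ab_group_add) ainf_map"
  assumes "ainf_category B" "additive_on_chains B F" "graded_map A B f" "as \<in> chains A"
  shows "susp (block_sum F f) as = (\<Sum>bss\<in>cuts as. susp F (map (bar_map f) bss))"
proof -
  let ?e = "\<lambda>bss :: ('o, 'v) arr list list. eps (map length bss)
    + koszul (map (\<lambda>bs. 1 - int (length bs)) bss) (map degs bss)"
  have "susp (block_sum F f) as
      = (\<Sum>bss\<in>cuts as. sgn_pow (susp_exp as + ?e bss) (F (map (map_arr f) bss)))"
    by (simp add: susp_def block_sum_def cuts_def sgn_pow_sum sgn_pow_add)
  also have "\<dots> = (\<Sum>bss\<in>cuts as. susp F (map (bar_map f) bss))"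
  proof (rule sum.cong[OF refl])
    fix bss assume bss: "bss \<in> cuts as"
    have "F ([] @ map (bar_map f) bss)
        = sgn_pow (\<Sum>bs\<leftarrow>bss. susp_exp bs) (F ([] @ map (map_arr f) bss))"
      using bss assms map_map_arr_in_chains[OF assms(3,4) bss]
      by (intro additive_map_bar_map) (auto intro: block_in_chains)
    then have "susp F (map (bar_map f) bss)
        = sgn_pow (susp_exp (map (bar_map f) bss) + (\<Sum>bs\<leftarrow>bss. susp_exp bs))
            (F (map (map_arr f) bss))"
      by (simp add: susp_def sgn_pow_add)
    also have "\<dots> = sgn_pow (susp_exp as + ?e bss) (F (map (map_arr f) bss))"
      using even_block_sign[of bss f] bss by (intro sgn_pow_cong) (simp add: cuts_def; blast)
    finally show "sgn_pow (susp_exp as + ?e bss) (F (map (map_arr f) bss))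
        = susp F (map (bar_map f) bss)" ..
  qed
  finally show ?thesis .
qed

text \<open>
  With \<^verbatim>\<open>s\<close> and \<^verbatim>\<open>t\<close> the lengths of \<^verbatim>\<open>ys\<close> and
  \<^verbatim>\<open>zs\<close>, the suspension of \<^verbatim>\<open>xs @ bar_arr A ys # zs\<close> differs from that of
  \<^verbatim>\<open>xs @ ys @ zs\<close> by \<^verbatim>\<open>(s + 1) * sdeg xs + t\<close>, up to the suspension of
  \<^verbatim>\<open>ys\<close>; the exponent in \<^verbatim>\<open>insertion_sum\<close> is \<^verbatim>\<open>s * sdeg xs + t\<close>
  modulo 2, so \<^verbatim>\<open>sdeg xs\<close> remains.
\<close>
lemma susp_insertion_sum:
  fixes A :: "('k::field, 'o, 'v::ab_group_add) ainf"
  assumes "ainf_category A" "additive_on_chains A F" "as \<in> chains A"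
  shows "susp (insertion_sum A F) as
    = (\<Sum>(xs, ys, zs)\<in>splits as. sgn_pow (sdeg xs) (susp F (xs @ bar_arr A ys # zs)))"
proof -
  interpret ainf_category A by fact
  let ?e = "\<lambda>xs ys zs :: ('o, 'v) arr list. int (length ys) * int (length xs) + int (length zs)
    + (2 - int (length ys)) * degs xs"
  have "susp (insertion_sum A F) as
      = (\<Sum>(xs, ys, zs)\<in>splits as. sgn_pow (susp_exp as + ?e xs ys zs) (F (xs @ mu_arr A ys # zs)))"
    by (simp add: susp_def insertion_sum_def splits_def sgn_pow_sum sgn_pow_add case_prod_unfold)
  also have "\<dots> = (\<Sum>(xs, ys, zs)\<in>splits as. sgn_pow (sdeg xs) (susp F (xs @ bar_arr A ys # zs)))"
  proof (rule sum.cong[OF refl], clarify)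
    fix xs ys zs assume s: "(xs, ys, zs) \<in> splits as"
    have "F (xs @ bar_arr A ys # zs) = sgn_pow (susp_exp ys) (F (xs @ mu_arr A ys # zs))"
      using splits_in_chains(2)[OF assms(3) s] unfolding bar_arr_def mu_arr_def susp_def
      by (rule additive_sgn_pow[OF assms(1,2)])
    then have "sgn_pow (sdeg xs) (susp F (xs @ bar_arr A ys # zs))
        = sgn_pow (sdeg xs + susp_exp (xs @ bar_arr A ys # zs) + susp_exp ys)
            (F (xs @ mu_arr A ys # zs))"
      by (simp add: susp_def sgn_pow_add)
    also have "\<dots> = sgn_pow (susp_exp as + ?e xs ys zs) (F (xs @ mu_arr A ys # zs))"
    proof (rule sgn_pow_cong)
      have "as = xs @ ys @ zs" using s by (simp add: splits_def)
      then show "even (sdeg xs + susp_exp (xs @ bar_arr A ys # zs) + susp_exp ys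
          - (susp_exp as + ?e xs ys zs))"
        by (simp add: susp_exp_append sdeg_def) blast
    qed
    finally show "sgn_pow (susp_exp as + ?e xs ys zs) (F (xs @ mu_arr A ys # zs))
        = sgn_pow (sdeg xs) (susp F (xs @ bar_arr A ys # zs))" ..
  qed
  finally show ?thesis .
qed

section \<open>Composition of A-infinity functors\<close>

lemma obj_map_ainf_comp: "x \<in> objs A \<Longrightarrow> obj_map (ainf_comp A f g) x = obj_map f (obj_map g x)"
  by (simp add: ainf_comp_def compose_def)

lemma hom_map_ainf_comp: "as \<in> chains A \<Longrightarrow> hom_map (ainf_comp A f g) as = block_sum (hom_map f) g as"
  by (simp add: ainf_comp_def)

lemma cuts_not_Nil: "as \<noteq> [] \<Longrightarrow> bss \<in> cuts as \<Longrightarrow> bss \<noteq> []"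
  by (auto simp: cuts_def)

lemma last_last_cuts: "bss \<in> cuts as \<Longrightarrow> as \<noteq> [] \<Longrightarrow> last (last bss) = last as"
  by (cases bss rule: rev_cases) (auto simp: cuts_def)

lemma hd_hd_cuts: "bss \<in> cuts as \<Longrightarrow> as \<noteq> [] \<Longrightarrow> hd (hd bss) = hd as"
  by (cases bss) (auto simp: cuts_def)

lemma degs_map_bar_map:
  "degs (map (bar_map f) bss) = degs (concat bss) + int (length bss) - int (length (concat bss))"
  by (induction bss) auto

text \<open>
  The summands of a component of a composite lie in the same hom-space in the same degree, so
  that \<^verbatim>\<open>additive_expand\<close> applies to lists of such components.
\<close>
lemma bar_map_map_bar_map:
  assumes "as \<in> chains A" "bss \<in> cuts as"
  shows "src (bar_map f (map (bar_map g) bss)) = src (bar_map (ainf_comp A f g) as)"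
    "tgt (bar_map f (map (bar_map g) bss)) = tgt (bar_map (ainf_comp A f g) as)"
    "deg (bar_map f (map (bar_map g) bss)) = deg (bar_map (ainf_comp A f g) as)"
proof -
  have ne: "as \<noteq> []" "bss \<noteq> []"
    using assms cuts_not_Nil chains_not_Nil by blast+
  with last_last_cuts[OF assms(2)] hd_hd_cuts[OF assms(2)] chains_src_tgt[OF assms(1)]
  show "src (bar_map f (map (bar_map g) bss)) = src (bar_map (ainf_comp A f g) as)"
    "tgt (bar_map f (map (bar_map g) bss)) = tgt (bar_map (ainf_comp A f g) as)"
    by (auto simp: obj_map_ainf_comp last_map hd_map)
  show "deg (bar_map f (map (bar_map g) bss)) = deg (bar_map (ainf_comp A f g) as)"
    using assms(2) by (simp add: degs_map_bar_map cuts_def)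
qed

lemma susp_hom_map_ainf_comp:
  assumes "ainf_category B" "graded_map A B g" "additive_on_chains B (hom_map f)" "as \<in> chains A"
  shows "susp (hom_map (ainf_comp A f g)) as = (\<Sum>bss\<in>cuts as. susp (hom_map f) (map (bar_map g) bss))"
  using susp_block_sum[OF assms(1,3,2,4)] by (simp add: susp_def hom_map_ainf_comp assms(4))

lemma graded_map_ainf_comp:
  assumes "ainf_category B" "ainf_category C" "graded_map A B g" "graded_map B C f"
    and "additive_on_chains B (hom_map f)"
  shows "graded_map A C (ainf_comp A f g)"
proof -
  interpret C: ainf_category C by fact
  have "hom_map (ainf_comp A f g) as \<in> homs C (obj_map (ainf_comp A f g) (src (last as)))
      (obj_map (ainf_comp A f g) (tgt (hd as))) (degs as + 1 - int (length as))"
    (is "_ \<in> homs C ?x ?y ?d") if as: "as \<in> chains A" for as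
  proof -
    have obj: "?x \<in> objs C" "?y \<in> objs C"
      using assms(3,4) chains_src_tgt[OF as] by (auto simp: obj_map_ainf_comp graded_map_def)
    have "susp (hom_map f) (map (bar_map g) bss) \<in> homs C ?x ?y ?d" if bss: "bss \<in> cuts as" for bss
    proof -
      let ?b = "bar_map f (map (bar_map g) bss)"
      have "vec ?b \<in> homs C (src ?b) (tgt ?b) (deg ?b)"
        using bar_map_in_arrows[OF assms(2,4) map_bar_map_in_chains[OF assms(1,3) as bss]]
        unfolding arrows_def by blast
      then show ?thesis unfolding bar_map_map_bar_map[OF as bss] by simp
    qed
    with obj have "susp (hom_map (ainf_comp A f g)) as \<in> homs C ?x ?y ?d"
      unfolding susp_hom_map_ainf_comp[OF assms(1,3,5) as] by (intro C.homs_sum) auto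
    with obj have "sgn_pow (susp_exp as) (susp (hom_map (ainf_comp A f g)) as) \<in> homs C ?x ?y ?d"
      by (intro C.homs_sgn_pow)
    then show ?thesis by (simp add: susp_def)
  qed
  then show ?thesis using assms(3,4) by (auto simp: graded_map_def obj_map_ainf_comp)
qed

text \<open>
  The coalgebra map of a composite is the composite of the coalgebra maps, tested against an
  arbitrary additive \<^verbatim>\<open>H\<close>.  Expanding every block of the left side turns it into a sum
  over a coarse cut and refinements of its blocks, which \<^verbatim>\<open>sum_cuts_refine\<close> reorders.
  Taking for \<^verbatim>\<open>H\<close> a component of a third functor gives associativity, and taking the
  operations of \<^verbatim>\<open>C\<close> gives one side of the relations of the composite.
\<close>
lemma sum_cuts_bar_map_ainf_comp:
  assumes "ainf_category B" "ainf_category C" "graded_map A B g" "graded_map B C f"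
    and "additive_on_chains B (hom_map f)" "additive_on_chains C H" "as \<in> chains A"
  shows "(\<Sum>bss\<in>cuts as. H (map (bar_map (ainf_comp A f g)) bss))
    = (\<Sum>css\<in>cuts as. \<Sum>dss\<in>cuts (map (bar_map g) css). H (map (bar_map f) dss))"
proof -
  let ?\<phi> = "\<lambda>css. bar_map f (map (bar_map g) css)"
  have comp: "graded_map A C (ainf_comp A f g)" using assms(1-5) by (rule graded_map_ainf_comp)
  have "H ([] @ map (bar_map (ainf_comp A f g)) bss)
      = (\<Sum>csss\<in>listset (map cuts bss). H ([] @ map ?\<phi> csss))" if bss: "bss \<in> cuts as" for bss
  proof (rule additive_expand[OF assms(2,6)])
    show "[] @ map (bar_map (ainf_comp A f g)) bss \<in> chains C"
      using map_bar_map_in_chains[OF assms(2) comp assms(7) bss] by simp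
    fix bs assume "bs \<in> set bss"
    then have bs: "bs \<in> chains A" using block_in_chains[OF assms(7) bss] by blast
    show "vec (bar_map (ainf_comp A f g) bs) = (\<Sum>css\<in>cuts bs. vec (?\<phi> css))"
      using susp_hom_map_ainf_comp[OF assms(1,3,5) bs] by simp
    fix css assume css: "css \<in> cuts bs"
    then show "?\<phi> css \<in> arrows C \<and> src (?\<phi> css) = src (bar_map (ainf_comp A f g) bs) \<and>
        tgt (?\<phi> css) = tgt (bar_map (ainf_comp A f g) bs) \<and>
        deg (?\<phi> css) = deg (bar_map (ainf_comp A f g) bs)"
      using bar_map_in_arrows[OF assms(2,4) map_bar_map_in_chains[OF assms(1,3) bs css]]
        bar_map_map_bar_map[OF bs css] by blast
  qed simp
  then have "(\<Sum>bss\<in>cuts as. H (map (bar_map (ainf_comp A f g)) bss))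
      = (\<Sum>bss\<in>cuts as. \<Sum>csss\<in>listset (map cuts bss). H (map ?\<phi> csss))"
    by (intro sum.cong) auto
  also have "\<dots> = (\<Sum>css\<in>cuts as. \<Sum>csss\<in>cuts css. H (map ?\<phi> csss))"
    by (rule sum_cuts_refine)
  also have "\<dots> = (\<Sum>css\<in>cuts as. \<Sum>dss\<in>cuts (map (bar_map g) css). H (map (bar_map f) dss))"
    by (simp add: sum_cuts_map comp_def)
  finally show ?thesis .
qed

lemma cuts_around_in_cuts:
  "(xss, p, q, zss) \<in> cuts_around xs zs \<Longrightarrow> xss @ (p @ b # q) # zss \<in> cuts (xs @ b # zs)"
  by (auto simp: cuts_def cuts_around_def)

lemma cuts_around_in_chains:
  assumes "xs @ b # zs \<in> chains A" "(xss, p, q, zss) \<in> cuts_around xs zs"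
  shows "p @ b # q \<in> chains A"
    and "\<lbrakk>ainf_category B; graded_map A B g\<rbrakk> \<Longrightarrow>
      map (bar_map g) xss @ bar_map g (p @ b # q) # map (bar_map g) zss \<in> chains B"
  using block_in_chains[OF assms(1) cuts_around_in_cuts[OF assms(2)]]
    map_bar_map_in_chains[OF _ _ assms(1) cuts_around_in_cuts[OF assms(2)]] by auto

lemma bar_map_replace_vec:
  "bar_map g (p @ Arr x y d v # q) = Arr (src (bar_map g (p @ Arr x y d u # q)))
     (tgt (bar_map g (p @ Arr x y d u # q))) (deg (bar_map g (p @ Arr x y d u # q)))
     (susp (hom_map g) (p @ Arr x y d v # q))"
  by (rule arr_eqI; cases p; cases q) auto

text \<open>
  Each cut has exactly one block that contains the factor being varied, and the two multilinear
  functions are applied one after the other in that factor.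
\<close>
lemma multilinear_sum_cuts:
  assumes "ainf_category A" "ainf_category B" "vector_space s"
    and "graded_map A B g" "multilinear A (scl B) (hom_map g)" "multilinear B s H"
  shows "multilinear A s (\<lambda>as. \<Sum>bss\<in>cuts as. H (map (bar_map g) bss))"
proof -
  interpret A: ainf_category A by fact
  interpret B: ainf_category B by fact
  have g: "multilinear A (scl B) (susp (hom_map g))"
    using assms(5) B.vector_space_axioms by (rule multilinear_susp)
  show ?thesis
  proof (rule multilinearI)
    fix as bs x y d u v
    assume u: "as @ Arr x y d u # bs \<in> chains A" and v: "v \<in> homs A x y d"
    have *: "H (map (bar_map g) xss @ bar_map g (p @ Arr x y d (u + v) # q) # map (bar_map g) zss)
        = H (map (bar_map g) xss @ bar_map g (p @ Arr x y d u # q) # map (bar_map g) zss)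
        + H (map (bar_map g) xss @ bar_map g (p @ Arr x y d v # q) # map (bar_map g) zss)"
      if c: "(xss, p, q, zss) \<in> cuts_around as bs" for xss p q zss
    proof -
      obtain X Y D where L: "\<And>w. bar_map g (p @ Arr x y d w # q)
          = Arr X Y D (susp (hom_map g) (p @ Arr x y d w # q))"
        using bar_map_replace_vec[of g p x y d _ q u] by blast
      have pq: "p @ Arr x y d u # q \<in> chains A" using cuts_around_in_chains(1)[OF u c] .
      have "susp (hom_map g) (p @ Arr x y d v # q) \<in> homs B X Y D"
        using bar_map_in_arrows[OF assms(2,4) chains_replace_vec[OF pq v]] by (simp add: L)
      moreover have "map (bar_map g) xss @ Arr X Y D (susp (hom_map g) (p @ Arr x y d u # q))
          # map (bar_map g) zss \<in> chains B"
        using cuts_around_in_chains(2)[OF u c assms(2,4)] by (simp add: L)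
      ultimately show ?thesis
        unfolding L additive_plus[OF multilinear_imp_additive[OF g] pq v]
        by (intro additive_plus[OF multilinear_imp_additive[OF assms(6)]])
    qed
    then show "(\<Sum>bss\<in>cuts (as @ Arr x y d (u + v) # bs). H (map (bar_map g) bss))
        = (\<Sum>bss\<in>cuts (as @ Arr x y d u # bs). H (map (bar_map g) bss))
        + (\<Sum>bss\<in>cuts (as @ Arr x y d v # bs). H (map (bar_map g) bss))"
      unfolding sum_cuts_append_Cons sum.distrib[symmetric]
      by (intro sum.cong refl) (clarsimp simp: *)
  next
    fix as bs x y d u c
    assume u: "as @ Arr x y d u # bs \<in> chains A"
    have *: "H (map (bar_map g) xss @ bar_map g (p @ Arr x y d (scl A c u) # q) # map (bar_map g) zss)
        = s c (H (map (bar_map g) xss @ bar_map g (p @ Arr x y d u # q) # map (bar_map g) zss))"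
      if c: "(xss, p, q, zss) \<in> cuts_around as bs" for xss p q zss
    proof -
      obtain X Y D where L: "\<And>w. bar_map g (p @ Arr x y d w # q)
          = Arr X Y D (susp (hom_map g) (p @ Arr x y d w # q))"
        using bar_map_replace_vec[of g p x y d _ q u] by blast
      have pq: "p @ Arr x y d u # q \<in> chains A" using cuts_around_in_chains(1)[OF u c] .
      have "map (bar_map g) xss @ Arr X Y D (susp (hom_map g) (p @ Arr x y d u # q))
          # map (bar_map g) zss \<in> chains B"
        using cuts_around_in_chains(2)[OF u c assms(2,4)] by (simp add: L)
      then show ?thesis
        unfolding L multilinear_scale[OF g pq] by (rule multilinear_scale[OF assms(6)])
    qed
    show "(\<Sum>bss\<in>cuts (as @ Arr x y d (scl A c u) # bs). H (map (bar_map g) bss))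
        = s c (\<Sum>bss\<in>cuts (as @ Arr x y d u # bs). H (map (bar_map g) bss))"
      using assms(3) unfolding sum_cuts_append_Cons module_iff_vector_space[symmetric]
      by (subst module.scale_sum_right) (auto intro!: sum.cong simp: *)
  qed
qed

lemma multilinear_ainf_comp:
  assumes "ainf_category A" "ainf_category B" "vector_space s"
    and "graded_map A B g" "multilinear A (scl B) (hom_map g)" "multilinear B s (hom_map f)"
  shows "multilinear A s (hom_map (ainf_comp A f g))"
proof (rule multilinear_cong[OF assms(1)])
  let ?G = "\<lambda>as. \<Sum>bss\<in>cuts as. susp (hom_map f) (map (bar_map g) bss)"
  show "multilinear A s (susp ?G)"
    using multilinear_sum_cuts[OF assms(1-5) multilinear_susp[OF assms(6,3)]] assms(3)
    by (rule multilinear_susp)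
  show "susp ?G as = hom_map (ainf_comp A f g) as" if "as \<in> chains A" for as
    using susp_hom_map_ainf_comp[OF assms(2,4) multilinear_imp_additive[OF assms(6)] that]
    by (metis susp_def sgn_pow_cancel)
qed

text \<open>
  The coalgebra map of a functor commutes with the bar differentials, tested against an arbitrary
  additive \<^verbatim>\<open>H\<close>.  Both sides are regrouped according to a distinguished block: on the
  left the one that contains the inserted operation of \<^verbatim>\<open>A\<close>, on the right the
  concatenation of the blocks to whose values the operation of \<^verbatim>\<open>B\<close> is applied.  The factors outside it
  agree, and inside it the relation of \<^verbatim>\<open>g\<close> applies.
\<close>
lemma bar_map_chain_map:
  assumes A: "ainf_category A" and B: "ainf_category B" and g: "ainf_functor A B g"
    and H: "additive_on_chains B H" and as: "as \<in> chains A"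
  shows "(\<Sum>(xs, ys, zs)\<in>splits as. sgn_pow (sdeg xs)
      (\<Sum>bss\<in>cuts (xs @ bar_arr A ys # zs). H (map (bar_map g) bss)))
    = (\<Sum>css\<in>cuts as. \<Sum>(xs, ys, zs)\<in>splits (map (bar_map g) css).
      sgn_pow (sdeg xs) (H (xs @ bar_arr B ys # zs)))"
proof -
  interpret A: ainf_category A by fact
  interpret B: ainf_category B by fact
  interpret g: ainf_functor A B g by fact
  let ?g = "map (bar_map g)"
  have g_add: "additive_on_chains A (hom_map g)"
    using g.hom_map_multilinear by (rule multilinear_imp_additive)
  have mu_add: "additive_on_chains B (mu B)"
    using B.mu_multilinear by (rule multilinear_imp_additive)
  have *: "(\<Sum>(p, ys, q)\<in>splits us. sgn_pow (sdeg (concat xss @ p))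
        (H (?g xss @ bar_map g (p @ bar_arr A ys # q) # ?g zss)))
      = (\<Sum>yss\<in>cuts us. sgn_pow (sdeg (?g xss)) (H (?g xss @ bar_arr B (?g yss) # ?g zss)))"
    if m: "(xss, us, zss) \<in> marked_cuts as" for xss us zss
  proof -
    have css: "xss @ us # zss \<in> cuts as" using m by (auto simp: marked_cuts_def cuts_def)
    have us: "us \<in> chains A" using block_in_chains[OF as css, of us] by simp
    \<comment> \<open>End points and degree shared by all terms of the relation of \<^verbatim>\<open>g\<close> on
      \<^verbatim>\<open>us\<close>, so that the terms can be added inside one factor.\<close>
    define X Y D where XYD: "X = obj_map g (src (last us))" "Y = obj_map g (tgt (hd us))"
      "D = degs us + 2 - int (length us)"
    have obj: "X \<in> objs B" "Y \<in> objs B"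
      unfolding XYD using graded_map_objs[OF g.graded_map us] by auto
    have chain: "?g xss @ Arr X Y D 0 # ?g zss \<in> chains B"
      using chains_replace1[of "?g xss" "bar_map g us" "?g zss" B "Arr X Y D 0"]
        map_bar_map_in_chains[OF B g.graded_map as css] obj B.homs_0[OF obj] by (simp add: XYD)
    have L: "bar_map g (p @ bar_arr A ys # q) = Arr X Y D (susp (hom_map g) (p @ bar_arr A ys # q))"
      and L_chain: "p @ bar_arr A ys # q \<in> chains A"
      if s: "(p, ys, q) \<in> splits us" for p ys q
    proof -
      show "p @ bar_arr A ys # q \<in> chains A" using A.splits_in_chains(3)[OF us s] .
      from s have "us = p @ ys @ q" "ys \<noteq> []" by (auto simp: splits_def)
      then show "bar_map g (p @ bar_arr A ys # q)
          = Arr X Y D (susp (hom_map g) (p @ bar_arr A ys # q))"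
        unfolding XYD by (intro arr_eqI; cases p; cases q) auto
    qed
    have R: "bar_arr B (?g yss) = Arr X Y D (susp (mu B) (?g yss))" if y: "yss \<in> cuts us" for yss
      using last_last_cuts[OF y] hd_hd_cuts[OF y] chains_not_Nil[OF us] cuts_not_Nil[OF _ y] y
      by (intro arr_eqI) (auto simp: XYD last_map hd_map degs_map_bar_map cuts_def)
    have vL: "susp (hom_map g) (p @ bar_arr A ys # q) \<in> homs B X Y D"
      if s: "(p, ys, q) \<in> splits us" for p ys q
      using bar_map_in_arrows[OF B g.graded_map L_chain[OF s]] unfolding L[OF s] by simp
    have vR: "susp (mu B) (?g yss) \<in> homs B X Y D" if y: "yss \<in> cuts us" for yss
      using B.bar_arr_in_arrows[OF map_bar_map_in_chains[OF B g.graded_map us y]]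
      unfolding R[OF y] by simp
    have rel: "(\<Sum>(p, ys, q)\<in>splits us. sgn_pow (sdeg p) (susp (hom_map g) (p @ bar_arr A ys # q)))
        = (\<Sum>yss\<in>cuts us. susp (mu B) (?g yss))"
    proof -
      have "susp (insertion_sum A (hom_map g)) us = susp (block_sum (mu B) g) us"
        using g.hom_map_relation[OF us] by (simp add: susp_def)
      then show ?thesis
        using susp_insertion_sum[OF A g_add us] susp_block_sum[OF B mu_add g.graded_map us] by simp
    qed
    let ?s = "sgn_pow (sdeg (concat xss))"
    have "(\<Sum>(p, ys, q)\<in>splits us. sgn_pow (sdeg (concat xss @ p))
        (H (?g xss @ bar_map g (p @ bar_arr A ys # q) # ?g zss)))
      = (\<Sum>(p, ys, q)\<in>splits us. ?s (sgn_pow (sdeg p)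
        (H (?g xss @ Arr X Y D (susp (hom_map g) (p @ bar_arr A ys # q)) # ?g zss))))"
      by (intro sum.cong refl) (auto simp: L sgn_pow_add)
    also have "\<dots> = ?s (\<Sum>(p, ys, q)\<in>splits us.
        H (?g xss @ Arr X Y D (sgn_pow (sdeg p) (susp (hom_map g) (p @ bar_arr A ys # q))) # ?g zss))"
      unfolding sgn_pow_sum using vL
      by (intro sum.cong refl) (auto simp: additive_sgn_pow[OF B H chains_replace_vec[OF chain]])
    also have "\<dots> = ?s (H (?g xss @ Arr X Y D (\<Sum>(p, ys, q)\<in>splits us.
        sgn_pow (sdeg p) (susp (hom_map g) (p @ bar_arr A ys # q))) # ?g zss))"
      using vL obj by (subst additive_sum[OF B H chain])
        (auto simp: case_prod_unfold intro!: B.homs_sgn_pow)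
    also have "\<dots> = ?s (H (?g xss @ Arr X Y D (\<Sum>yss\<in>cuts us. susp (mu B) (?g yss)) # ?g zss))"
      unfolding rel ..
    also have "\<dots> = ?s (\<Sum>yss\<in>cuts us. H (?g xss @ Arr X Y D (susp (mu B) (?g yss)) # ?g zss))"
      using vR by (subst additive_sum[OF B H chain]) auto
    also have "\<dots> = (\<Sum>yss\<in>cuts us. ?s (H (?g xss @ bar_arr B (?g yss) # ?g zss)))"
      unfolding sgn_pow_sum by (intro sum.cong refl) (simp add: R)
    also have "\<dots> = (\<Sum>yss\<in>cuts us. sgn_pow (sdeg (?g xss)) (H (?g xss @ bar_arr B (?g yss) # ?g zss)))"
      using even_sdeg_map_bar_map[of g xss]
      by (intro sum.cong refl sgn_pow_cong) simp
    finally show ?thesis .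
  qed
  have "(\<Sum>(xs, ys, zs)\<in>splits as. sgn_pow (sdeg xs)
      (\<Sum>bss\<in>cuts (xs @ bar_arr A ys # zs). H (?g bss)))
    = (\<Sum>(xs, ys, zs)\<in>splits as. \<Sum>(xss, p, q, zss)\<in>cuts_around xs zs.
        sgn_pow (sdeg (concat xss @ p)) (H (?g xss @ bar_map g (p @ bar_arr A ys # q) # ?g zss)))"
    unfolding sum_cuts_append_Cons sgn_pow_sum
    by (intro sum.cong refl) (auto simp: cuts_around_def intro!: sum.cong)
  also have "\<dots> = (\<Sum>(xss, us, zss)\<in>marked_cuts as. \<Sum>(p, ys, q)\<in>splits us.
        sgn_pow (sdeg (concat xss @ p)) (H (?g xss @ bar_map g (p @ bar_arr A ys # q) # ?g zss)))"
    by (rule sum_splits_cuts_around)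
  also have "\<dots> = (\<Sum>(xss, us, zss)\<in>marked_cuts as. \<Sum>yss\<in>cuts us.
        sgn_pow (sdeg (?g xss)) (H (?g xss @ bar_arr B (?g yss) # ?g zss)))"
    by (intro sum.cong refl) (clarsimp simp: * simp del: sdeg_simps)
  also have "\<dots> = (\<Sum>css\<in>cuts as. \<Sum>(xss, yss, zss)\<in>splits css.
        sgn_pow (sdeg (?g xss)) (H (?g xss @ bar_arr B (?g yss) # ?g zss)))"
    by (rule sum_cuts_splits[symmetric])
  also have "\<dots> = (\<Sum>css\<in>cuts as. \<Sum>(xs, ys, zs)\<in>splits (?g css).
      sgn_pow (sdeg xs) (H (xs @ bar_arr B ys # zs)))"
    by (simp only: sum_splits_map)
  finally show ?thesis .
qed

lemma cuts_singleton [simp]: "cuts [a] = {[[a]]}"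
proof (intro equalityI subsetI)
  fix bss assume "bss \<in> cuts [a]"
  then have "concat bss = [a]" "[] \<notin> set bss" by (auto simp: cuts_def)
  then obtain bs bss' where "bss = bs # bss'" "bs \<noteq> []" "bs @ concat bss' = [a]" "[] \<notin> set bss'"
    by (cases bss) auto
  then show "bss \<in> {[[a]]}"
    by (auto simp: append_eq_Cons_conv concat_eq_Nil_iff simp del: concat_eq_Nil_conv)
qed (auto simp: cuts_def)

lemma (in ainf_functor) bar_map_unit_arr:
  "x \<in> objs A \<Longrightarrow> bar_map f [unit_arr A x] = unit_arr B (obj_map f x)"
  using hom_map_unt[of x] by (simp add: bar_map_def susp_def unit_arr_def)

text \<open>
  The relations: the bar differential is carried through \<^verbatim>\<open>g\<close> by
  \<^verbatim>\<open>bar_map_chain_map\<close>, then through \<^verbatim>\<open>f\<close> by its own relations, and the two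
  coalgebra maps are composed.  The unit conditions: a unit lies in some block of each cut; if that
  block is longer, its value vanishes, and otherwise its value is a unit among several factors.
\<close>
lemma ainf_functor_ainf_comp:
  assumes A: "ainf_category A" and B: "ainf_category B" and C: "ainf_category C"
    and g: "ainf_functor A B g" and f: "ainf_functor B C f"
  shows "ainf_functor A C (ainf_comp A f g)"
proof -
  interpret A: ainf_category A by fact
  interpret B: ainf_category B by fact
  interpret C: ainf_category C by fact
  interpret g: ainf_functor A B g by fact
  interpret f: ainf_functor B C f by fact
  note f_add = multilinear_imp_additive[OF f.hom_map_multilinear]
  note muC_add = multilinear_imp_additive[OF C.mu_multilinear]
  let ?h = "ainf_comp A f g"
  note comp_eq = susp_hom_map_ainf_comp[OF B g.graded_map f_add]
  have graded: "graded_map A C ?h"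
    using B C g.graded_map f.graded_map f_add by (rule graded_map_ainf_comp)
  have mult: "multilinear A (scl C) (hom_map ?h)"
    using A B C.vector_space_axioms g.graded_map g.hom_map_multilinear f.hom_map_multilinear
    by (rule multilinear_ainf_comp)
  show ?thesis
  proof
    show "obj_map ?h \<in> objs A \<rightarrow>\<^sub>E objs C"
      using g.obj_map_in f.obj_map_in by (auto simp: ainf_comp_def compose_def)
    show "hom_map ?h \<in> extensional (chains A)" by (simp add: ainf_comp_def)
    show "multilinear A (scl C) (hom_map ?h)" by fact
  next
    fix as assume "as \<in> chains A"
    then show "hom_map ?h as \<in> homs C (obj_map ?h (src (last as))) (obj_map ?h (tgt (hd as)))
        (degs as + 1 - int (length as))"
      using graded by (simp add: graded_map_def)
  next
    fix as assume as: "as \<in> chains A"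
    have "susp (insertion_sum A (hom_map ?h)) as = (\<Sum>(xs, ys, zs)\<in>splits as. sgn_pow (sdeg xs)
        (\<Sum>bss\<in>cuts (xs @ bar_arr A ys # zs). susp (hom_map f) (map (bar_map g) bss)))"
      unfolding susp_insertion_sum[OF A multilinear_imp_additive[OF mult] as]
      by (intro sum.cong refl) (auto simp: comp_eq[OF A.splits_in_chains(3)[OF as]])
    also have "\<dots> = (\<Sum>css\<in>cuts as. \<Sum>(xs, ys, zs)\<in>splits (map (bar_map g) css).
        sgn_pow (sdeg xs) (susp (hom_map f) (xs @ bar_arr B ys # zs)))"
      using A B g additive_susp[OF f_add] as by (rule bar_map_chain_map)
    also have "\<dots> = (\<Sum>css\<in>cuts as. susp (insertion_sum B (hom_map f)) (map (bar_map g) css))"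
      using map_bar_map_in_chains[OF B g.graded_map as]
      by (intro sum.cong refl) (simp add: susp_insertion_sum[OF B f_add])
    also have "\<dots> = (\<Sum>css\<in>cuts as. susp (block_sum (mu C) f) (map (bar_map g) css))"
      using map_bar_map_in_chains[OF B g.graded_map as] f.hom_map_relation
      by (intro sum.cong refl) (simp add: susp_def)
    also have "\<dots> = (\<Sum>css\<in>cuts as. \<Sum>dss\<in>cuts (map (bar_map g) css). susp (mu C) (map (bar_map f) dss))"
      using map_bar_map_in_chains[OF B g.graded_map as]
      by (intro sum.cong refl) (simp add: susp_block_sum[OF C muC_add f.graded_map])
    also have "\<dots> = (\<Sum>bss\<in>cuts as. susp (mu C) (map (bar_map ?h) bss))"
      using B C g.graded_map f.graded_map f_add additive_susp[OF muC_add] as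
      by (rule sum_cuts_bar_map_ainf_comp[symmetric])
    also have "\<dots> = susp (block_sum (mu C) ?h) as"
      using C muC_add graded as by (rule susp_block_sum[symmetric])
    finally show "insertion_sum A (hom_map ?h) as = block_sum (mu C) ?h as" by (rule susp_inject)
  next
    fix x assume x: "x \<in> objs A"
    then have u: "[unit_arr A x] \<in> chains A" using A.unt_degree by (simp add: unit_arr_def)
    have gx: "obj_map g x \<in> objs B" using g.obj_map_in x by auto
    have "susp (hom_map ?h) [unit_arr A x] = susp (hom_map f) [bar_map g [unit_arr A x]]"
      by (simp add: comp_eq[OF u])
    also have "\<dots> = unt C (obj_map ?h x)"
      using f.hom_map_unt[OF gx] x by (simp add: susp_def g.bar_map_unit_arr obj_map_ainf_comp)
    finally show "hom_map ?h [unit_arr A x] = unt C (obj_map ?h x)" by (simp add: susp_def)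
  next
    fix as x assume as: "as \<in> chains A" "1 < length as" "x \<in> objs A" "unit_arr A x \<in> set as"
    have "susp (hom_map f) (map (bar_map g) bss) = 0" if bss: "bss \<in> cuts as" for bss
    proof -
      from bss as(4) obtain bs where bs: "bs \<in> set bss" "unit_arr A x \<in> set bs"
        by (auto simp: cuts_def)
      have chain: "bs \<in> chains A" "map (bar_map g) bss \<in> chains B"
        using block_in_chains[OF as(1) bss bs(1)] map_bar_map_in_chains[OF B g.graded_map as(1) bss]
        by auto
      show ?thesis
      proof (cases "length bs > 1")
        case True
        then have "vec (bar_map g bs) = 0"
          using g.hom_map_unt_zero[OF chain(1) _ as(3) bs(2)] by (simp add: susp_def)
        then show ?thesis
          using additive_vec_0[OF B additive_susp[OF f_add] chain(2), of "bar_map g bs"] bs(1)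
          by simp
      next
        case False
        with bs(2) have bs1: "bs = [unit_arr A x]" by (cases bs) auto
        have "length bss \<noteq> 1"
        proof
          assume "length bss = 1"
          with bs(1) have "bss = [bs]" by (cases bss) auto
          with bss bs1 as(2) show False by (auto simp: cuts_def)
        qed
        moreover have "length bss \<noteq> 0" using bs(1) by auto
        ultimately have "length (map (bar_map g) bss) > 1" unfolding length_map by linarith
        moreover have "unit_arr B (obj_map g x) \<in> set (map (bar_map g) bss)"
          using bs(1) unfolding bs1 by (auto simp flip: g.bar_map_unit_arr[OF as(3)])
        moreover have "obj_map g x \<in> objs B" using g.obj_map_in as(3) by auto
        ultimately have "hom_map f (map (bar_map g) bss) = 0"
          using f.hom_map_unt_zero[OF chain(2)] by blast
        then show ?thesis by (simp add: susp_def)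
      qed
    qed
    then have "susp (hom_map ?h) as = 0" by (simp add: comp_eq[OF as(1)])
    then show "hom_map ?h as = 0" by (metis susp_def sgn_pow_0(2) sgn_pow_cancel)
  qed
qed

lemma ainf_map_eqI:
  assumes "obj_map f = obj_map g" "hom_map f \<in> extensional S" "hom_map g \<in> extensional S"
    and "\<And>as. as \<in> S \<Longrightarrow> hom_map f as = hom_map g as"
  shows "f = (g :: ('o, 'v, 'p, 'w) ainf_map)"
proof -
  have "hom_map f = hom_map g" using assms(2-4) by (rule extensionalityI)
  with assms(1) show ?thesis by (cases f; cases g) simp
qed

lemma hom_map_ainf_comp_extensional: "hom_map (ainf_comp A f g) \<in> extensional (chains A)"
  by (simp add: ainf_comp_def)

lemma ainf_comp_assoc:
  assumes "ainf_category A" and B: "ainf_category B" and C: "ainf_category C" and "ainf_category D"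
    and f: "ainf_functor A B f" and g: "ainf_functor B C g" and h: "ainf_functor C D h"
  shows "ainf_comp A (ainf_comp B h g) f = ainf_comp A h (ainf_comp A g f)"
proof (rule ainf_map_eqI[where S = "chains A"])
  interpret f: ainf_functor A B f by fact
  interpret g: ainf_functor B C g by fact
  interpret h: ainf_functor C D h by fact
  interpret hg: ainf_functor B D "ainf_comp B h g" using assms(2-4) g h by (rule ainf_functor_ainf_comp)
  interpret gf: ainf_functor A C "ainf_comp A g f" using assms(1-3) f g by (rule ainf_functor_ainf_comp)
  note g_add = multilinear_imp_additive[OF g.hom_map_multilinear]
  note h_add = multilinear_imp_additive[OF h.hom_map_multilinear]
  note hg_add = multilinear_imp_additive[OF hg.hom_map_multilinear]
  have "obj_map f \<in> objs A \<rightarrow> objs B" using f.obj_map_in by auto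
  then show "obj_map (ainf_comp A (ainf_comp B h g) f) = obj_map (ainf_comp A h (ainf_comp A g f))"
    by (simp add: ainf_comp_def compose_assoc)
  fix as assume as: "as \<in> chains A"
  have "susp (hom_map (ainf_comp A (ainf_comp B h g) f)) as
      = (\<Sum>bss\<in>cuts as. susp (hom_map (ainf_comp B h g)) (map (bar_map f) bss))"
    using B f.graded_map hg_add as by (rule susp_hom_map_ainf_comp)
  also have "\<dots> = (\<Sum>bss\<in>cuts as. \<Sum>dss\<in>cuts (map (bar_map f) bss).
      susp (hom_map h) (map (bar_map g) dss))"
    using map_bar_map_in_chains[OF B f.graded_map as]
    by (intro sum.cong refl) (simp add: susp_hom_map_ainf_comp[OF C g.graded_map h_add])
  also have "\<dots> = (\<Sum>bss\<in>cuts as. susp (hom_map h) (map (bar_map (ainf_comp A g f)) bss))"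
    using B C f.graded_map g.graded_map g_add additive_susp[OF h_add] as
    by (rule sum_cuts_bar_map_ainf_comp[symmetric])
  also have "\<dots> = susp (hom_map (ainf_comp A h (ainf_comp A g f))) as"
    using C gf.graded_map h_add as by (rule susp_hom_map_ainf_comp[symmetric])
  finally show "hom_map (ainf_comp A (ainf_comp B h g) f) as
      = hom_map (ainf_comp A h (ainf_comp A g f)) as" by (rule susp_inject)
qed (rule hom_map_ainf_comp_extensional)+

section \<open>Strict functors and the category of A-infinity categories\<close>

text \<open>
  The common form of identities and simplex maps: no higher components, and a first component that
  leaves vectors unchanged.
\<close>
definition strict_map :: "('k, 'o, 'v::zero) ainf \<Rightarrow> ('o \<Rightarrow> 'p) \<Rightarrow> ('o, 'v, 'p, 'v) ainf_map" where
  "strict_map A \<theta> = \<lparr>obj_map = restrict \<theta> (objs A),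
     hom_map = (\<lambda>as\<in>chains A. if length as = 1 then vec (hd as) else 0)\<rparr>"

definition relabel :: "('o \<Rightarrow> 'p) \<Rightarrow> ('o, 'v) arr \<Rightarrow> ('p, 'v) arr" where
  "relabel \<theta> a = Arr (\<theta> (src a)) (\<theta> (tgt a)) (deg a) (vec a)"

lemma relabel_id [simp]: "relabel (\<lambda>x. x) = (\<lambda>a. a)"
  by (auto simp: relabel_def)

lemma ainf_id_eq_strict_map: "ainf_id A = strict_map A (\<lambda>x. x)"
  by (simp add: ainf_id_def strict_map_def)

lemma simplex_map_eq_strict_map: "simplex_map m \<theta> = strict_map (ainf_simplex m) \<theta>"
  by (simp add: simplex_map_def strict_map_def ainf_simplex_def)

lemma map_arr_strict_map: "a \<in> arrows A \<Longrightarrow> map_arr (strict_map A \<theta>) [a] = relabel \<theta> a"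
  by (auto simp: map_arr_def strict_map_def relabel_def arrows_def)

lemma hom_map_strict_map_0:
  "as \<in> chains A \<Longrightarrow> length as \<noteq> 1 \<Longrightarrow> hom_map (strict_map A \<theta>) as = 0"
  by (simp add: strict_map_def)

lemma all_singletons: "\<forall>bs\<in>set bss. length bs = 1 \<Longrightarrow> bss = map (\<lambda>a. [a]) (concat bss)"
  by (induction bss) (auto simp: length_Suc_conv)

text \<open>
  A cut with a longer block has a zero factor, and the cut into singletons has sign exponent 0
  because components with one argument have degree 0.
\<close>
lemma block_sum_strict:
  assumes "ainf_category B" "additive_on_chains B F" "graded_map A B f" "as \<in> chains A"
    and strict: "\<And>bs. \<lbrakk>bs \<in> chains A; length bs \<noteq> 1\<rbrakk> \<Longrightarrow> hom_map f bs = 0"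
  shows "block_sum F f as = F (map (\<lambda>a. map_arr f [a]) as)"
proof -
  let ?t = "\<lambda>bss. sgn_pow (eps (map length bss) + koszul (map (\<lambda>bs. 1 - int (length bs)) bss)
    (map degs bss)) (F (map (map_arr f) bss))"
  let ?s = "map (\<lambda>a. [a]) as"
  have "?t bss = 0" if bss: "bss \<in> cuts as" "bss \<noteq> ?s" for bss
  proof -
    from bss all_singletons[of bss] obtain bs where bs: "bs \<in> set bss" "length bs \<noteq> 1"
      by (auto simp: cuts_def)
    then have "vec (map_arr f bs) = 0"
      using strict[OF block_in_chains[OF assms(4) bss(1)]] by simp
    then have "F (map (map_arr f) bss) = 0"
      using additive_vec_0[OF assms(1,2) map_map_arr_in_chains[OF assms(3,4) bss(1)]] bs(1)
      by (metis image_eqI set_map)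
    then show ?thesis by simp
  qed
  moreover have "?s \<in> cuts as" by (auto simp: cuts_def)
  ultimately have "(\<Sum>bss\<in>cuts as. ?t bss) = (\<Sum>bss\<in>{?s}. ?t bss)"
    by (intro sum.mono_neutral_right) auto
  moreover have "eps (map length ?s) + koszul (map (\<lambda>bs. 1 - int (length bs)) ?s) (map degs ?s) = 0"
    by (simp add: eps_def koszul_def)
  ultimately show ?thesis by (simp add: block_sum_def cuts_def comp_def)
qed

lemma block_sum_singleton_arg:
  assumes "graded_map A B f" "as \<in> chains A"
    and "\<And>cs. \<lbrakk>cs \<in> chains B; length cs \<noteq> 1\<rbrakk> \<Longrightarrow> F cs = 0"
  shows "block_sum F f as = F [map_arr f as]"
proof -
  let ?t = "\<lambda>bss. sgn_pow (eps (map length bss) + koszul (map (\<lambda>bs. 1 - int (length bs)) bss)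
    (map degs bss)) (F (map (map_arr f) bss))"
  have "?t bss = 0" if bss: "bss \<in> cuts as" "bss \<noteq> [as]" for bss
  proof -
    have "length bss \<noteq> 1" using bss by (auto simp: cuts_def length_Suc_conv)
    then show ?thesis using assms(3)[OF map_map_arr_in_chains[OF assms(1,2) bss(1)]] by simp
  qed
  moreover have "[as] \<in> cuts as" using chains_not_Nil[OF assms(2)] by (auto simp: cuts_def)
  ultimately have "(\<Sum>bss\<in>cuts as. ?t bss) = (\<Sum>bss\<in>{[as]}. ?t bss)"
    by (intro sum.mono_neutral_right) auto
  then show ?thesis by (simp add: block_sum_def cuts_def eps_def koszul_def)
qed

text \<open>Only inserting the operation on the whole list leaves a list of length 1.\<close>
lemma insertion_sum_strict:
  assumes "ainf_category A" "as \<in> chains A"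
    and "\<And>bs. \<lbrakk>bs \<in> chains A; length bs \<noteq> 1\<rbrakk> \<Longrightarrow> F bs = 0"
  shows "insertion_sum A F as = F [mu_arr A as]"
proof -
  interpret ainf_category A by fact
  let ?t = "\<lambda>(xs, ys, zs). sgn_pow (int (length ys) * int (length xs) + int (length zs)
    + (2 - int (length ys)) * degs xs) (F (xs @ [mu_arr A ys] @ zs))"
  have "?t s = 0" if s: "s \<in> splits as" "s \<noteq> ([], as, [])" for s
  proof -
    obtain xs ys zs where [simp]: "s = (xs, ys, zs)" by (cases s) auto
    have "length (xs @ mu_arr A ys # zs) \<noteq> 1" using s by (auto simp: splits_def)
    with s have "F (xs @ mu_arr A ys # zs) = 0"
      by (intro assms(3) splits_in_chains(2)[OF assms(2)]) auto
    then show ?thesis by simp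
  qed
  moreover have "([], as, []) \<in> splits as" using chains_not_Nil[OF assms(2)] by (auto simp: splits_def)
  ultimately have "(\<Sum>s\<in>splits as. ?t s) = (\<Sum>s\<in>{([], as, [])}. ?t s)"
    by (intro sum.mono_neutral_right) auto
  then show ?thesis by (simp add: insertion_sum_def splits_def)
qed

text \<open>
  Without higher components, both sides of the relation on a tensor reduce to one term, namely the
  operation of \<^verbatim>\<open>A\<close> on it and the operation of \<^verbatim>\<open>B\<close> on the relabelled tensor.
\<close>
lemma ainf_functor_strict_map:
  assumes A: "ainf_category A" and B: "ainf_category B"
    and scl: "scl B = scl A" and ob: "\<theta> \<in> objs A \<rightarrow> objs B"
    and homs: "\<And>x y d. \<lbrakk>x \<in> objs A; y \<in> objs A\<rbrakk> \<Longrightarrow> homs A x y d \<subseteq> homs B (\<theta> x) (\<theta> y) d"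
    and mu: "\<And>as. as \<in> chains A \<Longrightarrow> mu B (map (relabel \<theta>) as) = mu A as"
    and unt: "\<And>x. x \<in> objs A \<Longrightarrow> unt B (\<theta> x) = unt A x"
  shows "ainf_functor A B (strict_map A \<theta>)"
proof -
  interpret A: ainf_category A by fact
  interpret B: ainf_category B by fact
  let ?s = "strict_map A \<theta>"
  have in_homs: "x \<in> objs A \<and> y \<in> objs A \<and> u \<in> homs A x y d"
    if "as @ Arr x y d u # bs \<in> chains A" for as bs x y d u
    using that by (auto simp: chains_def)
  have deg: "hom_map ?s as \<in> homs B (obj_map ?s (src (last as))) (obj_map ?s (tgt (hd as)))
      (degs as + 1 - int (length as))" if as: "as \<in> chains A" for as
  proof (cases "length as = 1")
    case True
    then obtain a where "as = [a]" by (auto simp: length_Suc_conv)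
    with as homs show ?thesis by (auto simp: strict_map_def arrows_def)
  next
    case False
    then show ?thesis
      using as ob chains_src_tgt[OF as] by (auto simp: strict_map_def intro!: B.homs_0)
  qed
  then have graded: "graded_map A B ?s"
    using ob by (auto simp: graded_map_def strict_map_def)
  show ?thesis
  proof
    show "obj_map ?s \<in> objs A \<rightarrow>\<^sub>E objs B" using ob by (auto simp: strict_map_def)
    show "hom_map ?s \<in> extensional (chains A)" by (simp add: strict_map_def)
    show "multilinear A (scl B) (hom_map ?s)"
    proof (rule multilinearI)
      fix as bs x y d u v
      assume c: "as @ Arr x y d u # bs \<in> chains A" and v: "v \<in> homs A x y d"
      then have "as @ Arr x y d (u + v) # bs \<in> chains A" "as @ Arr x y d v # bs \<in> chains A"
        using in_homs[OF c] by (auto intro: chains_replace_vec[OF c] A.homs_add)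
      with c show "hom_map ?s (as @ Arr x y d (u + v) # bs)
          = hom_map ?s (as @ Arr x y d u # bs) + hom_map ?s (as @ Arr x y d v # bs)"
        by (simp add: strict_map_def)
    next
      fix as bs x y d u c
      assume ch: "as @ Arr x y d u # bs \<in> chains A"
      then have "as @ Arr x y d (scl A c u) # bs \<in> chains A"
        using in_homs[OF ch] by (auto intro: chains_replace_vec[OF ch] A.homs_scl)
      with ch show "hom_map ?s (as @ Arr x y d (scl A c u) # bs)
          = scl B c (hom_map ?s (as @ Arr x y d u # bs))"
        by (simp add: strict_map_def scl)
    qed
  next
    fix as assume as: "as \<in> chains A"
    then have "insertion_sum A (hom_map ?s) as = hom_map ?s [mu_arr A as]"
      by (intro insertion_sum_strict[OF A] hom_map_strict_map_0)
    also have "\<dots> = mu A as" using A.mu_arr_in_arrows[OF as] by (simp add: strict_map_def)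
    also have "\<dots> = mu B (map (\<lambda>a. map_arr ?s [a]) as)"
    proof -
      have "map (\<lambda>a. map_arr ?s [a]) as = map (relabel \<theta>) as"
        using as by (auto simp: chains_def map_arr_strict_map)
      then show ?thesis using mu[OF as] by (simp only:)
    qed
    also have "\<dots> = block_sum (mu B) ?s as"
      using block_sum_strict[OF B multilinear_imp_additive[OF B.mu_multilinear] graded as]
      by (simp add: hom_map_strict_map_0)
    finally show "insertion_sum A (hom_map ?s) as = block_sum (mu B) ?s as" .
  next
    fix x assume x: "x \<in> objs A"
    then have "[unit_arr A x] \<in> chains A" using A.unt_degree by (simp add: unit_arr_def)
    with x show "hom_map ?s [unit_arr A x] = unt B (obj_map ?s x)"
      using unt by (simp add: strict_map_def unit_arr_def)
  qed (simp_all add: deg hom_map_strict_map_0)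
qed

lemma ainf_functor_ainf_id:
  assumes "ainf_category A"
  shows "ainf_functor A A (ainf_id A)"
  using assms unfolding ainf_id_eq_strict_map by (intro ainf_functor_strict_map) auto

lemma hom_map_ainf_comp_strict_map:
  assumes "ainf_category B" "ainf_functor A B (strict_map A \<theta>)" "ainf_functor B C f" "as \<in> chains A"
  shows "hom_map (ainf_comp A f (strict_map A \<theta>)) as = hom_map f (map (relabel \<theta>) as)"
proof -
  interpret s: ainf_functor A B "strict_map A \<theta>" by fact
  interpret f: ainf_functor B C f by fact
  have "block_sum (hom_map f) (strict_map A \<theta>) as
      = hom_map f (map (\<lambda>a. map_arr (strict_map A \<theta>) [a]) as)"
    using multilinear_imp_additive[OF f.hom_map_multilinear] assms(1,4) s.graded_map
    by (intro block_sum_strict hom_map_strict_map_0)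
  moreover have "map (\<lambda>a. map_arr (strict_map A \<theta>) [a]) as = map (relabel \<theta>) as"
    using assms(4) by (auto simp: chains_def map_arr_strict_map)
  ultimately show ?thesis using assms(4) by (simp add: hom_map_ainf_comp)
qed

lemma ainf_comp_id_right:
  assumes "ainf_category A" "ainf_functor A B f"
  shows "ainf_comp A f (ainf_id A) = f"
proof (rule ainf_map_eqI[where S = "chains A"])
  interpret f: ainf_functor A B f by fact
  show "obj_map (ainf_comp A f (ainf_id A)) = obj_map f"
    using f.obj_map_in by (auto simp: ainf_comp_def ainf_id_def compose_def fun_eq_iff PiE_def
        extensional_def)
  show "hom_map (ainf_comp A f (ainf_id A)) as = hom_map f as" if "as \<in> chains A" for as
    using hom_map_ainf_comp_strict_map[OF assms(1) _ assms(2) that, of "\<lambda>x. x"]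
      ainf_functor_ainf_id[OF assms(1)] by (simp add: ainf_id_eq_strict_map)
  show "hom_map f \<in> extensional (chains A)" by (rule f.hom_map_extensional)
qed (rule hom_map_ainf_comp_extensional)

lemma ainf_comp_id_left:
  assumes "ainf_functor A B f"
  shows "ainf_comp A (ainf_id B) f = f"
proof (rule ainf_map_eqI[where S = "chains A"])
  interpret f: ainf_functor A B f by fact
  show "obj_map (ainf_comp A (ainf_id B) f) = obj_map f"
    using f.obj_map_in by (auto simp: ainf_comp_def ainf_id_def compose_def fun_eq_iff PiE_def
        extensional_def)
  show "hom_map (ainf_comp A (ainf_id B) f) as = hom_map f as" if as: "as \<in> chains A" for as
  proof -
    have "hom_map (ainf_comp A (ainf_id B) f) as = hom_map (ainf_id B) [map_arr f as]"
      unfolding hom_map_ainf_comp[OF as] using f.graded_map as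
      by (rule block_sum_singleton_arg) (simp add: ainf_id_def)
    then show ?thesis using map_arr_in_arrows[OF f.graded_map as] by (simp add: ainf_id_def)
  qed
  show "hom_map f \<in> extensional (chains A)" by (rule f.hom_map_extensional)
qed (rule hom_map_ainf_comp_extensional)

lemma category_AInf_Cat: "category AInf_Cat"
  by unfold_locales
    (auto simp: AInf_Cat_def ainf_functor_ainf_id ainf_comp_id_left ainf_comp_id_right
      intro: ainf_functor_ainf_comp ainf_comp_assoc)

section \<open>The cosimplicial A-infinity category of simplices\<close>

lemma ainf_simplex_sel [simp]:
  "objs (ainf_simplex n) = {..n}"
  "homs (ainf_simplex n) i j d = (if i \<le> j \<and> d = 0 then UNIV else {0})"
  "scl (ainf_simplex n) = (*)"
  "mu (ainf_simplex n) as = (if length as = 2 then vec (as ! 0) * vec (as ! 1) else 0)"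
  "unt (ainf_simplex n) i = 1"
  by (simp_all add: ainf_simplex_def)

lemma arrows_ainf_simplex:
  "a \<in> arrows (ainf_simplex n) \<longleftrightarrow>
    src a \<le> n \<and> tgt a \<le> n \<and> (vec a = 0 \<or> src a \<le> tgt a \<and> deg a = 0)"
  by (auto simp: arrows_def)

text \<open>
  Two nested binary products need three factors, and there the relation is associativity of the
  multiplication of scalars: the bracketings of \<^verbatim>\<open>[a, b, c]\<close> have opposite signs.
\<close>
lemma insertion_sum_ainf_simplex:
  fixes as :: "(nat, 'k::field) arr list"
  shows "insertion_sum (ainf_simplex n) (mu (ainf_simplex n)) as = 0"
proof -
  let ?S = "ainf_simplex n :: ('k, nat, 'k) ainf"
  let ?t = "\<lambda>(xs, ys, zs). sgn_pow (int (length ys) * int (length xs) + int (length zs)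
    + (2 - int (length ys)) * degs xs) (mu ?S (xs @ [mu_arr ?S ys] @ zs))"
  have t0: "?t s = 0" if "length (fst (snd s)) \<noteq> 2 \<or> length (fst s) + length (snd (snd s)) \<noteq> 1" for s
  proof (cases s)
    case (fields xs ys zs)
    have "mu ?S (xs @ [mu_arr ?S ys] @ zs) = 0"
    proof (cases "length (xs @ [mu_arr ?S ys] @ zs) = 2")
      case True
      with that fields have "length ys \<noteq> 2" by auto
      then have "vec (mu_arr ?S ys) = 0" by simp
      moreover from True have "xs = [] \<and> (\<exists>z. zs = [z]) \<or> (\<exists>x. xs = [x]) \<and> zs = []"
        by (cases xs; cases zs) auto
      ultimately show ?thesis by (elim disjE exE conjE) simp_all
    qed simp
    with fields show ?thesis by simp
  qed
  have "(\<Sum>s\<in>splits as. ?t s) = 0"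
  proof (cases "length as = 3")
    case False
    then show ?thesis by (intro sum.neutral ballI t0) (auto simp: splits_def)
  next
    case True
    then obtain a b c where as: "as = [a, b, c]" by (auto simp: numeral_3_eq_3 length_Suc_conv)
    let ?s1 = "([], [a, b], [c])" and ?s2 = "([a], [b, c], [])"
    have "?t s = 0" if s: "s \<in> splits as - {?s1, ?s2}" for s
    proof (rule t0, rule ccontr)
      assume "\<not> (length (fst (snd s)) \<noteq> 2 \<or> length (fst s) + length (snd (snd s)) \<noteq> 1)"
      with s show False
        by (cases s; cases "fst s") (auto simp: splits_def as numeral_2_eq_2 length_Suc_conv)
    qed
    moreover have "{?s1, ?s2} \<subseteq> splits as" by (auto simp: splits_def as)
    ultimately have "(\<Sum>s\<in>splits as. ?t s) = (\<Sum>s\<in>{?s1, ?s2}. ?t s)"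
      by (intro sum.mono_neutral_right finite_splits ballI)
    also have "\<dots> = 0" by (simp add: sgn_pow_def mult.assoc)
    finally show ?thesis .
  qed
  then show ?thesis by (simp add: insertion_sum_def splits_def)
qed

lemma ainf_category_ainf_simplex: "ainf_category (ainf_simplex n :: ('k::field, nat, 'k) ainf)"
proof -
  let ?S = "ainf_simplex n :: ('k, nat, 'k) ainf"
  interpret V: vector_space "(*) :: 'k \<Rightarrow> 'k \<Rightarrow> 'k"
    by unfold_locales (auto simp: algebra_simps)
  have length2: "Suc (length as + length bs) \<noteq> 2 \<or> as = [] \<and> (\<exists>b. bs = [b]) \<or> (\<exists>a. as = [a] \<and> bs = [])"
    for as bs :: "(nat, 'k) arr list"
    by (cases as; cases bs; cases "tl as"; cases "tl bs") auto
  show ?thesis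
  proof (intro ainf_category.intro ainf_category_axioms.intro)
    show "vector_space (scl ?S)" using V.vector_space_axioms by simp
    show "module.subspace (scl ?S) (homs ?S x y d)" for x y d
      by (simp add: V.subspace_single_0)
    show "multilinear ?S (scl ?S) (mu ?S)"
    proof (rule multilinearI)
      show "mu ?S (as @ Arr x y d (u + v) # bs)
          = mu ?S (as @ Arr x y d u # bs) + mu ?S (as @ Arr x y d v # bs)" for as bs x y d u v
        using length2[of as bs] by (elim disjE exE conjE) (simp_all add: algebra_simps)
      show "mu ?S (as @ Arr x y d (scl ?S c u) # bs)
          = scl ?S c (mu ?S (as @ Arr x y d u # bs))" for as bs x y d u c
        using length2[of as bs] by (elim disjE exE conjE) simp_all
    qed
    show "mu ?S as \<in> homs ?S (src (last as)) (tgt (hd as)) (degs as + 2 - int (length as))"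
      if as: "as \<in> chains ?S" for as
    proof (cases "length as = 2")
      case True
      then obtain a b where "as = [a, b]" by (auto simp: numeral_2_eq_2 length_Suc_conv)
      with as show ?thesis by (auto simp: chains_def arrows_ainf_simplex)
    qed simp
  qed (auto simp: insertion_sum_ainf_simplex unit_arr_def)
qed

lemma ainf_functor_simplex_map:
  assumes "\<theta> \<in> {..m} \<rightarrow> {..n}" "mono_on {..m} \<theta>"
  shows "ainf_functor (ainf_simplex m) (ainf_simplex n)
    (simplex_map m \<theta> :: (nat, 'k::field, nat, 'k) ainf_map)"
  unfolding simplex_map_eq_strict_map
proof (rule ainf_functor_strict_map[OF ainf_category_ainf_simplex ainf_category_ainf_simplex])
  show "mu (ainf_simplex n) (map (relabel \<theta>) as) = mu (ainf_simplex m) as"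
    for as :: "(nat, 'k) arr list"
    by (auto simp: relabel_def)
qed (use assms in \<open>auto simp: mono_on_def\<close>)

lemma simplex_map_id: "simplex_map n (\<lambda>k\<in>{..n}. k) = ainf_id (ainf_simplex n)"
  by (simp add: simplex_map_def ainf_id_def restrict_def fun_eq_iff)

text \<open>
  Precomposing with the strict \<^verbatim>\<open>simplex_map l \<phi>\<close> relabels a chain, and relabelling keeps
  the vectors, which are all that \<^verbatim>\<open>simplex_map m \<theta>\<close> depends on.
\<close>
lemma simplex_map_compose:
  assumes \<phi>: "\<phi> \<in> {..l} \<rightarrow> {..m}" "mono_on {..l} \<phi>" and \<theta>: "\<theta> \<in> {..m} \<rightarrow> {..n}" "mono_on {..m} \<theta>"
  shows "ainf_comp (ainf_simplex l) (simplex_map m \<theta>) (simplex_map l \<phi>)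
    = (simplex_map l (compose {..l} \<theta> \<phi>) :: (nat, 'k::field, nat, 'k) ainf_map)"
proof (rule ainf_map_eqI[where S = "chains (ainf_simplex l)"])
  let ?c = "ainf_comp (ainf_simplex l) (simplex_map m \<theta>) (simplex_map l \<phi>)
    :: (nat, 'k, nat, 'k) ainf_map"
  show "obj_map ?c = obj_map (simplex_map l (compose {..l} \<theta> \<phi>) :: (nat, 'k, nat, 'k) ainf_map)"
    using \<phi>(1) by (auto simp: ainf_comp_def simplex_map_def compose_def fun_eq_iff)
  fix as :: "(nat, 'k) arr list" assume as: "as \<in> chains (ainf_simplex l)"
  have f: "ainf_functor (ainf_simplex l) (ainf_simplex m)
      (simplex_map l \<phi> :: (nat, 'k, nat, 'k) ainf_map)"
    using \<phi> by (rule ainf_functor_simplex_map)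
  have g: "ainf_functor (ainf_simplex m) (ainf_simplex n)
      (simplex_map m \<theta> :: (nat, 'k, nat, 'k) ainf_map)"
    using \<theta> by (rule ainf_functor_simplex_map)
  have "hom_map ?c as = hom_map (simplex_map m \<theta>) (map (relabel \<phi>) as)"
    using hom_map_ainf_comp_strict_map[OF ainf_category_ainf_simplex _ g as, of \<phi>] f
    by (simp add: simplex_map_eq_strict_map)
  moreover have "map (relabel \<phi>) as \<in> chains (ainf_simplex m)"
  proof -
    interpret f: ainf_functor "ainf_simplex l" "ainf_simplex m"
      "simplex_map l \<phi> :: (nat, 'k, nat, 'k) ainf_map" by fact
    have "map (\<lambda>a. map_arr (simplex_map l \<phi>) [a]) as \<in> chains (ainf_simplex m)"
      using map_map_arr_in_chains[OF f.graded_map as, of "map (\<lambda>a. [a]) as"]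
      by (auto simp: cuts_def comp_def)
    also have "map (\<lambda>a. map_arr (simplex_map l \<phi>) [a]) as = map (relabel \<phi>) as"
      using as unfolding simplex_map_eq_strict_map by (auto simp: chains_def map_arr_strict_map)
    finally show ?thesis .
  qed
  ultimately show "hom_map ?c as = hom_map (simplex_map l (compose {..l} \<theta> \<phi>)) as"
    using as chains_not_Nil[OF as] by (simp add: simplex_map_def hd_map relabel_def)
qed (simp_all add: ainf_comp_def simplex_map_def)

section \<open>Functor categories and presheaf categories\<close>

lemma category_op_cat: "category C \<Longrightarrow> category (op_cat C)"
  by (auto simp: category_def op_cat_def)

lemma category_Set_cat: "category Set_cat"
proof
  fix W X Y Z :: "'s set" and f g h
  assume "f \<in> Hom Set_cat W X"
  then have "f \<in> W \<rightarrow> X" by (auto simp: Set_cat_def)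
  then show "Comp Set_cat W X Z (Comp Set_cat X Y Z h g) f = Comp Set_cat W Y Z h (Comp Set_cat W X Y g f)"
    by (simp add: Set_cat_def compose_assoc)
qed (auto simp: Set_cat_def compose_def fun_eq_iff PiE_def extensional_def)

lemma category_Delta_cat: "category Delta_cat"
proof
  fix W X Y Z :: nat and f g h
  assume "f \<in> Hom Delta_cat W X"
  then have "f \<in> {..W} \<rightarrow> {..X}" by (auto simp: Delta_cat_def)
  then show "Comp Delta_cat W X Z (Comp Delta_cat X Y Z h g) f
      = Comp Delta_cat W Y Z h (Comp Delta_cat W X Y g f)"
    by (simp add: Delta_cat_def compose_assoc)
next
  fix X Y Z :: nat and f g
  assume f: "f \<in> Hom Delta_cat X Y" and g: "g \<in> Hom Delta_cat Y Z"
  then show "Comp Delta_cat X Y Z g f \<in> Hom Delta_cat X Z"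
    by (auto simp: Delta_cat_def compose_def mono_on_def PiE_iff)
qed (auto simp: Delta_cat_def compose_def fun_eq_iff PiE_def extensional_def mono_on_def)

lemma category_functor_cat:
  assumes "category C" "category D"
  shows "category (functor_cat C D)"
proof -
  interpret C: category C by fact
  interpret D: category D by fact
  show ?thesis
  proof
    fix F assume "F \<in> Ob (functor_cat C D)"
    then interpret F: cat_functor C D F by (simp add: functor_cat_def)
    show "Id (functor_cat C D) F \<in> Hom (functor_cat C D) F F"
      by (auto simp: functor_cat_def nat_trans_def F.on_ob_in_Ob D.Id_in_Hom
          D.Comp_Id_left[OF _ _ F.on_hom_in_Hom] D.Comp_Id_right[OF _ _ F.on_hom_in_Hom])
  next
    fix F G \<eta>
    assume "F \<in> Ob (functor_cat C D)" "G \<in> Ob (functor_cat C D)"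
      and \<eta>: "\<eta> \<in> Hom (functor_cat C D) F G"
    then interpret F: cat_functor C D F + G: cat_functor C D G by (simp_all add: functor_cat_def)
    from \<eta> have "\<eta> \<in> extensional (Ob C)" "\<And>X. X \<in> Ob C \<Longrightarrow> \<eta> X \<in> Hom D (on_ob F X) (on_ob G X)"
      by (auto simp: functor_cat_def nat_trans_def)
    then show "Comp (functor_cat C D) F G G (Id (functor_cat C D) G) \<eta> = \<eta>"
      and "Comp (functor_cat C D) F F G \<eta> (Id (functor_cat C D) F) = \<eta>"
      by (auto simp: functor_cat_def F.on_ob_in_Ob G.on_ob_in_Ob D.Comp_Id_left D.Comp_Id_right
          intro!: extensionalityI[where A = "Ob C"])
  next
    fix F G H \<eta> \<theta>
    assume "F \<in> Ob (functor_cat C D)" "G \<in> Ob (functor_cat C D)" "H \<in> Ob (functor_cat C D)"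
      and \<eta>: "\<eta> \<in> Hom (functor_cat C D) F G" and \<theta>: "\<theta> \<in> Hom (functor_cat C D) G H"
    then interpret F: cat_functor C D F + G: cat_functor C D G + H: cat_functor C D H
      by (simp_all add: functor_cat_def)
    note ob = F.on_ob_in_Ob G.on_ob_in_Ob H.on_ob_in_Ob
    from \<eta> \<theta> have in_Hom: "\<And>X. X \<in> Ob C \<Longrightarrow> \<eta> X \<in> Hom D (on_ob F X) (on_ob G X)"
        "\<And>X. X \<in> Ob C \<Longrightarrow> \<theta> X \<in> Hom D (on_ob G X) (on_ob H X)"
      and nat: "\<And>X Y f. \<lbrakk>X \<in> Ob C; Y \<in> Ob C; f \<in> Hom C X Y\<rbrakk> \<Longrightarrow>
          Comp D (on_ob F X) (on_ob F Y) (on_ob G Y) (\<eta> Y) (on_hom F X Y f)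
          = Comp D (on_ob F X) (on_ob G X) (on_ob G Y) (on_hom G X Y f) (\<eta> X)"
        "\<And>X Y f. \<lbrakk>X \<in> Ob C; Y \<in> Ob C; f \<in> Hom C X Y\<rbrakk> \<Longrightarrow>
          Comp D (on_ob G X) (on_ob G Y) (on_ob H Y) (\<theta> Y) (on_hom G X Y f)
          = Comp D (on_ob G X) (on_ob H X) (on_ob H Y) (on_hom H X Y f) (\<theta> X)"
      by (auto simp: functor_cat_def nat_trans_def)
    let ?c = "\<lambda>X. Comp D (on_ob F X) (on_ob G X) (on_ob H X) (\<theta> X) (\<eta> X)"
    have "Comp D (on_ob F X) (on_ob F Y) (on_ob H Y) (?c Y) (on_hom F X Y f)
        = Comp D (on_ob F X) (on_ob H X) (on_ob H Y) (on_hom H X Y f) (?c X)"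
      if *: "X \<in> Ob C" "Y \<in> Ob C" "f \<in> Hom C X Y" for X Y f
    proof -
      have "Comp D (on_ob F X) (on_ob F Y) (on_ob H Y) (?c Y) (on_hom F X Y f)
          = Comp D (on_ob F X) (on_ob G Y) (on_ob H Y) (\<theta> Y)
              (Comp D (on_ob F X) (on_ob F Y) (on_ob G Y) (\<eta> Y) (on_hom F X Y f))"
        using * by (intro D.Comp_assoc ob in_Hom F.on_hom_in_Hom)
      also have "\<dots> = Comp D (on_ob F X) (on_ob G Y) (on_ob H Y) (\<theta> Y)
              (Comp D (on_ob F X) (on_ob G X) (on_ob G Y) (on_hom G X Y f) (\<eta> X))"
        by (simp only: nat(1)[OF *])
      also have "\<dots> = Comp D (on_ob F X) (on_ob G X) (on_ob H Y)
              (Comp D (on_ob G X) (on_ob G Y) (on_ob H Y) (\<theta> Y) (on_hom G X Y f)) (\<eta> X)"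
        using * by (intro D.Comp_assoc[symmetric] ob in_Hom G.on_hom_in_Hom)
      also have "\<dots> = Comp D (on_ob F X) (on_ob G X) (on_ob H Y)
              (Comp D (on_ob G X) (on_ob H X) (on_ob H Y) (on_hom H X Y f) (\<theta> X)) (\<eta> X)"
        by (simp only: nat(2)[OF *])
      also have "\<dots> = Comp D (on_ob F X) (on_ob H X) (on_ob H Y) (on_hom H X Y f) (?c X)"
        using * by (intro D.Comp_assoc ob in_Hom H.on_hom_in_Hom)
      finally show ?thesis .
    qed
    moreover have "?c X \<in> Hom D (on_ob F X) (on_ob H X)" if "X \<in> Ob C" for X
      using that by (intro D.Comp_in_Hom[of _ "on_ob G X"] ob in_Hom)
    ultimately show "Comp (functor_cat C D) F G H \<theta> \<eta> \<in> Hom (functor_cat C D) F H"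
      by (simp add: functor_cat_def nat_trans_def)
  next
    fix F G H K \<eta> \<theta> \<zeta>
    assume "F \<in> Ob (functor_cat C D)" "G \<in> Ob (functor_cat C D)" "H \<in> Ob (functor_cat C D)"
      "K \<in> Ob (functor_cat C D)"
      and h: "\<eta> \<in> Hom (functor_cat C D) F G" "\<theta> \<in> Hom (functor_cat C D) G H"
        "\<zeta> \<in> Hom (functor_cat C D) H K"
    then interpret F: cat_functor C D F + G: cat_functor C D G + H: cat_functor C D H
      + K: cat_functor C D K by (simp_all add: functor_cat_def)
    from h have "\<eta> X \<in> Hom D (on_ob F X) (on_ob G X)" "\<theta> X \<in> Hom D (on_ob G X) (on_ob H X)"
      "\<zeta> X \<in> Hom D (on_ob H X) (on_ob K X)" if "X \<in> Ob C" for X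
      using that by (auto simp: functor_cat_def nat_trans_def)
    then show "Comp (functor_cat C D) F G K (Comp (functor_cat C D) G H K \<zeta> \<theta>) \<eta>
        = Comp (functor_cat C D) F H K \<zeta> (Comp (functor_cat C D) F G H \<theta> \<eta>)"
      by (auto simp: functor_cat_def intro!: restrict_ext D.Comp_assoc F.on_ob_in_Ob G.on_ob_in_Ob
          H.on_ob_in_Ob K.on_ob_in_Ob)
  qed
qed

section \<open>The nerve\<close>

lemma nerve_simplices_comp:
  assumes "ainf_category A" "ainf_category B" "ainf_functor A B g" "f \<in> nerve_simplices A n"
  shows "ainf_comp (ainf_simplex n) g f \<in> nerve_simplices B n"
  using assms ainf_functor_ainf_comp[OF ainf_category_ainf_simplex assms(1,2)]
  by (simp add: nerve_simplices_def)

text \<open>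
  Precomposition with simplex maps is contravariant by associativity, and because simplex maps
  compose like the monotone maps that they come from.
\<close>
lemma cat_functor_nerve:
  assumes A: "ainf_category A"
  shows "cat_functor (op_cat Delta_cat) Set_cat (nerve A)"
proof (intro cat_functor.intro cat_functor_axioms.intro category_op_cat category_Delta_cat
    category_Set_cat)
  fix n m \<theta>
  assume "\<theta> \<in> Hom (op_cat Delta_cat) n m"
  then have \<theta>: "ainf_functor (ainf_simplex m) (ainf_simplex n) (simplex_map m \<theta>)"
    by (intro ainf_functor_simplex_map) (auto simp: op_cat_def Delta_cat_def)
  then show "on_hom (nerve A) n m \<theta> \<in> Hom Set_cat (on_ob (nerve A) n) (on_ob (nerve A) m)"
    using ainf_functor_ainf_comp[OF ainf_category_ainf_simplex ainf_category_ainf_simplex A \<theta>]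
    by (auto simp: nerve_def Set_cat_def nerve_simplices_def)
next
  fix n
  show "on_hom (nerve A) n n (Id (op_cat Delta_cat) n) = Id Set_cat (on_ob (nerve A) n)"
    by (auto simp: nerve_def Set_cat_def op_cat_def Delta_cat_def nerve_simplices_def simplex_map_id
        ainf_comp_id_right ainf_category_ainf_simplex intro!: restrict_ext)
next
  fix n m l \<theta> \<phi>
  assume h: "\<theta> \<in> Hom (op_cat Delta_cat) n m" "\<phi> \<in> Hom (op_cat Delta_cat) m l"
  then have \<theta>: "\<theta> \<in> {..m} \<rightarrow> {..n}" "mono_on {..m} \<theta>" and \<phi>: "\<phi> \<in> {..l} \<rightarrow> {..m}" "mono_on {..l} \<phi>"
    by (auto simp: op_cat_def Delta_cat_def)
  note \<theta>_functor = ainf_functor_simplex_map[OF \<theta>] and \<phi>_functor = ainf_functor_simplex_map[OF \<phi>]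
  have "ainf_comp (ainf_simplex l) f (simplex_map l (compose {..l} \<theta> \<phi>))
      = ainf_comp (ainf_simplex l) (ainf_comp (ainf_simplex m) f (simplex_map m \<theta>)) (simplex_map l \<phi>)"
    if "f \<in> nerve_simplices A n" for f
    using that ainf_comp_assoc[OF ainf_category_ainf_simplex ainf_category_ainf_simplex
        ainf_category_ainf_simplex A \<phi>_functor \<theta>_functor, of f]
    by (simp add: nerve_simplices_def simplex_map_compose[OF \<phi> \<theta>])
  moreover have "ainf_comp (ainf_simplex m) f (simplex_map m \<theta>) \<in> nerve_simplices A m"
    if "f \<in> nerve_simplices A n" for f
    using that ainf_functor_ainf_comp[OF ainf_category_ainf_simplex ainf_category_ainf_simplex A
        \<theta>_functor] by (simp add: nerve_simplices_def)
  ultimately show "on_hom (nerve A) n l (Comp (op_cat Delta_cat) n m l \<phi> \<theta>)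
      = Comp Set_cat (on_ob (nerve A) n) (on_ob (nerve A) m) (on_ob (nerve A) l)
          (on_hom (nerve A) m l \<phi>) (on_hom (nerve A) n m \<theta>)"
    by (auto simp: nerve_def Set_cat_def op_cat_def Delta_cat_def compose_def intro!: restrict_ext)
qed (auto simp: Set_cat_def)

text \<open>
  Naturality is associativity in the other grouping: \<^verbatim>\<open>g\<close> acts on the left,
  \<^verbatim>\<open>\<theta>\<close> on the right.
\<close>
lemma nerve_push_nat_trans:
  assumes A: "ainf_category A" and B: "ainf_category B" and g: "ainf_functor A B g"
  shows "nerve_push A B g \<in> nat_trans (op_cat Delta_cat) Set_cat (nerve A) (nerve B)"
proof -
  have "ainf_comp (ainf_simplex m) g (ainf_comp (ainf_simplex m) f (simplex_map m \<theta>))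
      = ainf_comp (ainf_simplex m) (ainf_comp (ainf_simplex n) g f) (simplex_map m \<theta>)"
    and "ainf_comp (ainf_simplex m) f (simplex_map m \<theta>) \<in> nerve_simplices A m"
    if f: "f \<in> nerve_simplices A n" and \<theta>: "\<theta> \<in> Hom Delta_cat m n" for n m f \<theta>
  proof -
    have \<theta>_functor: "ainf_functor (ainf_simplex m) (ainf_simplex n) (simplex_map m \<theta>)"
      using \<theta> by (intro ainf_functor_simplex_map) (auto simp: Delta_cat_def)
    have f_functor: "ainf_functor (ainf_simplex n) A f" using f by (simp add: nerve_simplices_def)
    show "ainf_comp (ainf_simplex m) g (ainf_comp (ainf_simplex m) f (simplex_map m \<theta>))
        = ainf_comp (ainf_simplex m) (ainf_comp (ainf_simplex n) g f) (simplex_map m \<theta>)"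
      using ainf_comp_assoc[OF ainf_category_ainf_simplex ainf_category_ainf_simplex A B
          \<theta>_functor f_functor g] by simp
    show "ainf_comp (ainf_simplex m) f (simplex_map m \<theta>) \<in> nerve_simplices A m"
      using ainf_functor_ainf_comp[OF ainf_category_ainf_simplex ainf_category_ainf_simplex A
          \<theta>_functor f_functor] by (simp add: nerve_simplices_def)
  qed
  then show ?thesis
    using nerve_simplices_comp[OF A B g]
    by (auto simp: nat_trans_def nerve_push_def nerve_def Set_cat_def op_cat_def Delta_cat_def
        compose_def intro!: restrict_ext)
qed

theorem proposition2p2p7:
  shows "cat_functor
    (AInf_Cat :: (('k::field, 'o, 'v::ab_group_add) ainf, ('o, 'v, 'o, 'v) ainf_map) cat)
    (SSet :: ((nat, 'k, 'o, 'v) ainf_map sset, _) cat)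
    \<lparr>on_ob = nerve, on_hom = nerve_push\<rparr>"
proof (intro cat_functor.intro cat_functor_axioms.intro)
  show "category AInf_Cat" by (rule category_AInf_Cat)
  show "category SSet"
    unfolding SSet_def
    by (intro category_functor_cat category_op_cat category_Delta_cat category_Set_cat)
next
  fix A :: "('k, 'o, 'v) ainf"
  assume "A \<in> Ob AInf_Cat"
  then show "on_ob \<lparr>on_ob = nerve, on_hom = nerve_push\<rparr> A \<in> Ob SSet"
    by (simp add: AInf_Cat_def SSet_def functor_cat_def cat_functor_nerve)
  show "on_hom \<lparr>on_ob = nerve, on_hom = nerve_push\<rparr> A A (Id AInf_Cat A)
      = Id SSet (on_ob \<lparr>on_ob = nerve, on_hom = nerve_push\<rparr> A)"
    by (auto simp: AInf_Cat_def SSet_def functor_cat_def nerve_push_def nerve_def Set_cat_def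
        op_cat_def Delta_cat_def nerve_simplices_def ainf_comp_id_left fun_eq_iff restrict_def)
next
  fix A B :: "('k, 'o, 'v) ainf" and g
  assume "A \<in> Ob AInf_Cat" "B \<in> Ob AInf_Cat" "g \<in> Hom AInf_Cat A B"
  then show "on_hom \<lparr>on_ob = nerve, on_hom = nerve_push\<rparr> A B g
      \<in> Hom SSet (on_ob \<lparr>on_ob = nerve, on_hom = nerve_push\<rparr> A)
          (on_ob \<lparr>on_ob = nerve, on_hom = nerve_push\<rparr> B)"
    by (simp add: AInf_Cat_def SSet_def functor_cat_def nerve_push_nat_trans)
next
  fix A B C :: "('k, 'o, 'v) ainf" and g h
  assume "A \<in> Ob AInf_Cat" "B \<in> Ob AInf_Cat" "C \<in> Ob AInf_Cat"
    "g \<in> Hom AInf_Cat A B" "h \<in> Hom AInf_Cat B C"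
  then have ABC: "ainf_category A" "ainf_category B" "ainf_category C"
    and g: "ainf_functor A B g" and h: "ainf_functor B C h"
    by (auto simp: AInf_Cat_def)
  have "ainf_comp (ainf_simplex n) (ainf_comp A h g) f
      = ainf_comp (ainf_simplex n) h (ainf_comp (ainf_simplex n) g f)"
    if "f \<in> nerve_simplices A n" for n f
    using that ainf_comp_assoc[OF ainf_category_ainf_simplex ABC _ g h]
    by (simp add: nerve_simplices_def)
  then show "on_hom \<lparr>on_ob = nerve, on_hom = nerve_push\<rparr> A C (Comp AInf_Cat A B C h g)
      = Comp SSet (on_ob \<lparr>on_ob = nerve, on_hom = nerve_push\<rparr> A)
          (on_ob \<lparr>on_ob = nerve, on_hom = nerve_push\<rparr> B)
          (on_ob \<lparr>on_ob = nerve, on_hom = nerve_push\<rparr> C)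
          (on_hom \<lparr>on_ob = nerve, on_hom = nerve_push\<rparr> B C h)
          (on_hom \<lparr>on_ob = nerve, on_hom = nerve_push\<rparr> A B g)"
    using nerve_simplices_comp[OF ABC(1,2) g]
    by (auto simp: AInf_Cat_def SSet_def functor_cat_def nerve_push_def nerve_def Set_cat_def
        op_cat_def Delta_cat_def compose_def fun_eq_iff)
qed

end
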